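(* Let $\Pi$ and $\widehat{\Pi}$ be Eulerian posets of rank $n$ and let $\phi:\widehat{\Pi}\to\Pi$ be a strong Eulerian subdivision. For $\sigma\in\Pi$ put $\widehat{\sigma}:=P_1(\phi^{-1}[\hat 0,\sigma])$. Then $$\Phi_{\widehat{\Pi}}=\sum_{\sigma\in\Pi}\Phi^{\ell}_{\widehat{\sigma}}\cdot\Phi_{[\sigma,\hat 1]},$$ where $[\sigma,\hat 1]$ is the interval in $\Pi$ and the products are taken in the ring of noncommutative polynomials in $c,d$.
   Context: All posets are finite and graded with rank function $\rho$. A graded poset with minimum $\hat0$ and maximum $\hat1$ is Eulerian if every interval $[s,t]$ with $s<t$ has equally many elements of even and odd rank; a poset is lower Eulerian if it has a $\hat 0$ and all its intervals are Eulerian. For a poset $Q$, $P_1(Q)$ is $Q$ with a new maximum element adjoined. For a graded poset $P$ of rank $m+1$ with $\hat0,\hat1$ and $S\subseteq[m]$, let $\alpha_P(S)$ be the number of maximal chains of $\{x\in P:\rho(x)\in S\}$, $\beta_P(S)=\sum_{T\subseteq S}(-1)^{|S\setminus T|}\alpha_P(T)$, and $u_S=u_1\cdots u_m$ the noncommutative word with $u_i=b$ if $i\in S$ and $u_i=a$ otherwise. The ab-index is $\Psi_P=\sum_{S}\beta_P(S)u_S$. If $P$ is Eulerian there is a unique noncommutative polynomial $\Phi_P(c,d)$ (the cd-index) with $\Phi_P(a+b,ab+ba)=\Psi_P(a,b)$. A poset $P$ is near-Eulerian if $P=Q\setminus\{x\}$ for an Eulerian poset $Q$ of rank $m+1$ and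 a coatom $x$ of $Q$; $Q$ is uniquely determined by $P$ and is called the semisuspension $\widetilde{\Sigma}P$; the boundary $\partial P$ is the poset $[\hat0,x)_Q$ with a new maximum adjoined (an Eulerian poset). The local cd-index of a near-Eulerian $P$ is $\Phi^{\ell}_P:=\Phi_{\widetilde{\Sigma}P}-\Phi_{\partial P}\cdot c$. A strong Eulerian subdivision between lower Eulerian posets $\widehat P,P$ of rank $n$ is a surjective order-preserving map $\phi:\widehat P\to P$ such that for every $\sigma\in P$, $P_1(\phi^{-1}[\hat0,\sigma])$ is near-Eulerian and $\phi^{-1}[\hat0,\sigma]$ has rank $\rho_P(\sigma)$. (For $\sigma=\hat1$, $\Phi^\ell_{\widehat\sigma}=0$, so the corresponding term is zero regardless of the convention for the cd-index of the one-element interval $[\hat1,\hat1]$.)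
   Formalization: Added hypothesis: only the maximum of Π̂ maps to the maximum of Π (else false: two disjoint digons with 0̂, 1̂ over one digon). Convention: the 2-element chain, which is σ̂ for σ = 0̂, counts as near-Eulerian with local cd-index 1 (else no strong Eulerian subdivision exists). *)

theory Defs
  imports Complex_Main "HOL-Library.Poly_Mapping"
begin

section \<open>Posets\<close>

text \<open>A poset is its order relation \<open>r\<close> (\<open>(x, y) \<in> r\<close> means \<open>x \<le> y\<close>); as \<open>r\<close> is reflexive, its
  set of elements is \<open>Field r\<close>, and the subposet on \<open>A\<close> is \<open>Restr r A\<close>.\<close>

definition covers :: "'a rel \<Rightarrow> 'a \<Rightarrow> 'a \<Rightarrow> bool" where
  "covers r x y \<longleftrightarrow> (x, y) \<in> r \<and> x \<noteq> y \<and> (\<forall>z. (x, z) \<in> r \<and> (z, y) \<in> r \<longrightarrow> z = x \<or> z = y)"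

definition rank_function :: "'a rel \<Rightarrow> ('a \<Rightarrow> nat) \<Rightarrow> bool" where
  "rank_function r \<rho> \<longleftrightarrow>
     (\<forall>x\<in>Field r. (\<forall>y. (y, x) \<in> r \<longrightarrow> y = x) \<longrightarrow> \<rho> x = 0) \<and>
     (\<forall>x y. covers r x y \<longrightarrow> \<rho> y = \<rho> x + 1)"

definition graded_poset :: "'a rel \<Rightarrow> bool" where
  "graded_poset r \<longleftrightarrow> finite r \<and> Partial_order r \<and> (\<exists>\<rho>. rank_function r \<rho>)"

text \<open>On a graded poset the rank function is unique on \<open>Field r\<close>; values elsewhere are irrelevant.\<close>

definition rk :: "'a rel \<Rightarrow> 'a \<Rightarrow> nat" where
  "rk r = (SOME \<rho>. rank_function r \<rho>)"

definition poset_rank :: "'a rel \<Rightarrow> nat" where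
  "poset_rank r = Max (rk r ` Field r)"

definition is_bot :: "'a rel \<Rightarrow> 'a \<Rightarrow> bool" where
  "is_bot r x \<longleftrightarrow> x \<in> Field r \<and> (\<forall>y\<in>Field r. (x, y) \<in> r)"

definition is_top :: "'a rel \<Rightarrow> 'a \<Rightarrow> bool" where
  "is_top r x \<longleftrightarrow> x \<in> Field r \<and> (\<forall>y\<in>Field r. (y, x) \<in> r)"

definition top_elem :: "'a rel \<Rightarrow> 'a" where
  "top_elem r = (THE x. is_top r x)"

definition coatom :: "'a rel \<Rightarrow> 'a \<Rightarrow> bool" where
  "coatom r x \<longleftrightarrow> (\<exists>t. is_top r t \<and> covers r x t)"

definition interval :: "'a rel \<Rightarrow> 'a \<Rightarrow> 'a \<Rightarrow> 'a rel" where
  "interval r s t = Restr r {x. (s, x) \<in> r \<and> (x, t) \<in> r}"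

definition eulerian :: "'a rel \<Rightarrow> bool" where
  "eulerian r \<longleftrightarrow> graded_poset r \<and> (\<exists>x. is_bot r x) \<and> (\<exists>x. is_top r x) \<and>
     (\<forall>s t. (s, t) \<in> r \<and> s \<noteq> t \<longrightarrow>
        card {x \<in> Field (interval r s t). even (rk r x)} =
        card {x \<in> Field (interval r s t). odd (rk r x)})"

definition lower_eulerian :: "'a rel \<Rightarrow> bool" where
  "lower_eulerian r \<longleftrightarrow> graded_poset r \<and> (\<exists>x. is_bot r x) \<and>
     (\<forall>s t. (s, t) \<in> r \<longrightarrow> eulerian (interval r s t))"

text \<open>\<open>P1 r\<close> is \<open>r\<close> (embedded by \<open>Some\<close>) with a new maximum \<open>None\<close>.\<close>

definition P1 :: "'a rel \<Rightarrow> 'a option rel" where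
  "P1 r = map_prod Some Some ` r \<union> insert None (Some ` Field r) \<times> {None}"


section \<open>Noncommutative polynomials, the ab-index and the cd-index\<close>

text \<open>The free monoid, written additively so that the multiplication of
  \<^typ>\<open>'m \<Rightarrow>\<^sub>0 int\<close> (convolution over the additive monoid \<open>'m\<close>) is that of the free
  associative ring on the letters.\<close>

datatype 'x nc_word = NC_Word (letters: "'x list")

instantiation nc_word :: (type) monoid_add
begin
definition zero_nc_word :: "'a nc_word" where "0 = NC_Word []"
definition plus_nc_word :: "'a nc_word \<Rightarrow> 'a nc_word \<Rightarrow> 'a nc_word" where
  "v + w = NC_Word (letters v @ letters w)"
instance by standard (simp_all add: zero_nc_word_def plus_nc_word_def)
end

type_synonym 'x nc_poly = "'x nc_word \<Rightarrow>\<^sub>0 int"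

definition nc_var :: "'x \<Rightarrow> 'x nc_poly" where
  "nc_var x = Poly_Mapping.single (NC_Word [x]) 1"

definition nc_subst :: "('x \<Rightarrow> 'y nc_poly) \<Rightarrow> 'x nc_poly \<Rightarrow> 'y nc_poly" where
  "nc_subst f p = (\<Sum>w\<in>Poly_Mapping.keys p.
     of_int (Poly_Mapping.lookup p w) * prod_list (map f (letters w)))"

datatype ab = A | B
datatype cd = C | D

fun cd_to_ab :: "cd \<Rightarrow> ab nc_poly" where
  "cd_to_ab C = nc_var A + nc_var B"
| "cd_to_ab D = nc_var A * nc_var B + nc_var B * nc_var A"

definition maximal_chains :: "'a rel \<Rightarrow> 'a set set" where
  "maximal_chains r = {K \<in> Chains r. \<forall>L\<in>Chains r. K \<subseteq> L \<longrightarrow> L = K}"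

definition flag_alpha :: "'a rel \<Rightarrow> nat set \<Rightarrow> nat" where
  "flag_alpha r S = card (maximal_chains (Restr r {x. rk r x \<in> S}))"

definition flag_beta :: "'a rel \<Rightarrow> nat set \<Rightarrow> int" where
  "flag_beta r S = (\<Sum>T\<in>Pow S. (- 1) ^ card (S - T) * int (flag_alpha r T))"

definition ab_word :: "nat \<Rightarrow> nat set \<Rightarrow> ab nc_word" where
  "ab_word m S = NC_Word (map (\<lambda>i. if i \<in> S then B else A) [1..<m + 1])"

text \<open>For a poset of rank \<open>m + 1\<close>. By truncated subtraction, the one-element poset gets index \<open>1\<close>.\<close>

definition ab_index :: "'a rel \<Rightarrow> ab nc_poly" where
  "ab_index r = (let m = poset_rank r - 1 in
     \<Sum>S\<in>Pow {1..m}. Poly_Mapping.single (ab_word m S) (flag_beta r S))"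

definition cd_index :: "'a rel \<Rightarrow> cd nc_poly" where
  "cd_index r = (THE \<Phi>. nc_subst cd_to_ab \<Phi> = ab_index r)"


section \<open>Near-Eulerian posets and the local cd-index\<close>

text \<open>\<open>Q\<close> is an Eulerian poset with a coatom whose removal leaves \<open>P\<close>. The removed coatom is named
  \<open>None\<close> and \<open>P\<close> is embedded by \<open>Some\<close>, which is no restriction up to isomorphism.\<close>

definition is_semisuspension :: "'a rel \<Rightarrow> 'a option rel \<Rightarrow> bool" where
  "is_semisuspension P Q \<longleftrightarrow> eulerian Q \<and> coatom Q None \<and>
     Restr Q (Field Q - {None}) = map_prod Some Some ` P"

definition semisuspension :: "'a rel \<Rightarrow> 'a option rel" where
  "semisuspension P = (THE Q. is_semisuspension P Q)"

definition boundary :: "'a rel \<Rightarrow> 'a option option rel" where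
  "boundary P = (let Q = semisuspension P in P1 (Restr Q {y. (y, None) \<in> Q \<and> y \<noteq> None}))"

definition two_chain :: "'a rel \<Rightarrow> bool" where
  "two_chain r \<longleftrightarrow> (\<exists>x y. x \<noteq> y \<and> r = {(x, x), (x, y), (y, y)})"

text \<open>The chain with two elements has no semisuspension, but it is \<open>P1\<close> of the one-element poset
  and hence arises for every subdivision at the minimum. It counts as near-Eulerian, with
  local cd-index \<open>1\<close>; the decomposition of the identity subdivision forces that value.\<close>

definition near_eulerian :: "'a rel \<Rightarrow> bool" where
  "near_eulerian P \<longleftrightarrow> two_chain P \<or> (\<exists>Q. is_semisuspension P Q)"

definition local_cd_index :: "'a rel \<Rightarrow> cd nc_poly" where
  "local_cd_index P = (if two_chain P then 1
     else cd_index (semisuspension P) - cd_index (boundary P) * nc_var C)"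


section \<open>Strong Eulerian subdivisions\<close>

definition below_preimage :: "'b rel \<Rightarrow> 'a rel \<Rightarrow> ('b \<Rightarrow> 'a) \<Rightarrow> 'a \<Rightarrow> 'b rel" where
  "below_preimage Ph P \<phi> \<sigma> = Restr Ph {x. (\<phi> x, \<sigma>) \<in> P}"

text \<open>Nothing here forces the fibre over a maximum of \<open>P\<close> to be the maximum of \<open>Ph\<close>: if \<open>Ph\<close> is the
  face poset of two disjoint digons with a maximum adjoined and \<open>P\<close> that of the first digon, one can
  send the second digon to the maximum of \<open>P\<close>. Statements that need this condition have to assume it.\<close>

definition strong_eulerian_subdivision :: "'b rel \<Rightarrow> 'a rel \<Rightarrow> ('b \<Rightarrow> 'a) \<Rightarrow> bool" where
  "strong_eulerian_subdivision Ph P \<phi> \<longleftrightarrow>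
     lower_eulerian Ph \<and> lower_eulerian P \<and> poset_rank Ph = poset_rank P \<and>
     \<phi> ` Field Ph = Field P \<and>
     (\<forall>x y. (x, y) \<in> Ph \<longrightarrow> (\<phi> x, \<phi> y) \<in> P) \<and>
     (\<forall>\<sigma>\<in>Field P. near_eulerian (P1 (below_preimage Ph P \<phi> \<sigma>)) \<and>
        poset_rank (below_preimage Ph P \<phi> \<sigma>) = rk P \<sigma>)"

end

theory Submission
  imports Defs
begin

text \<open>
  With \<open>e = a - b\<close>, the ab-index of an interval is the sum over its chains of the words
  \<open>e\<^sup>i b e\<^sup>j b \<cdots>\<close> recording the rank gaps. Sorting the chains by their largest or by their smallest
  element gives a right and a left recursion. Substituting \<open>c \<mapsto> a + b\<close>, \<open>d \<mapsto> ab + ba\<close> is injective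
  and has torsion-free cokernel, so the identity may be checked on ab-indices once cd-indices are
  known to exist; existence follows from a recursion for twice the ab-index in terms of
  \<open>c\<close> and \<open>e\<^sup>2 = c\<^sup>2 - 2 d\<close>.

  For a subdivision, write \<open>W y\<close> for the contribution of the chains with largest element \<open>y\<close>. The local
  cd-index at \<open>\<sigma>\<close> of rank \<open>k\<close> is the sum of \<open>W y e\<^bsup>k - rk y\<^esup>\<close> over the interior \<open>y\<close>, minus the
  sum of \<open>W y e\<^bsup>k - 1 - rk y\<^esup> b\<close> over the boundary. Euler characteristics and the condition on the top fibre
  show that each \<open>y\<close> is interior for exactly one \<open>\<sigma> \<ge> \<phi> y\<close>, and that this \<open>\<sigma>\<close> is \<open>\<phi> y\<close>. The coefficient of
  \<open>W y\<close> on the right-hand side then collapses by the left recursion in \<open>[\<phi> y, 1]\<close>.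
\<close>

section \<open>Substitution and cd-polynomials\<close>

text \<open>Inclusion and exclusion, which produces \<open>flag_beta\<close> from
  \<open>flag_alpha\<close>, acts on words as the substitution of \<open>a - b\<close> for
  \<open>a\<close>; hence \<open>e\<close> marks the ranks that a chain skips. As
  \<open>cd_index\<close> is a definite description, it carries information only where existence is
  known: for \<open>Ph\<close>, for the nontrivial intervals of \<open>P\<close>, and for every
  semisuspension and boundary. The existence proof cannot stay among posets, because cutting off the
  top ranks of an Eulerian poset destroys the Euler relations; integer weights on the elements
  absorb the defect. The posets involved live on different types and carry shifted or transported
  ranks. What is moved between them is \<open>psi\<close>, which depends only on the order between
  its two endpoints and on rank differences. A semisuspension is only known to exist. The
  information taken from it is which elements lie below its extra coatom, and an Euler relation
  makes this intrinsic to the preimage. Comparing these relations for all \<open>\<sigma>\<close> at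
  once is what locates the boundaries.\<close>

lemma frag_cmul_conv_mult: "frag_cmul k (p :: 'x nc_poly) = of_int k * p"
proof -
  have "frag_cmul k p = Poly_Mapping.map ((*) k) p"
    by (rule poly_mapping_eqI) (simp add: Poly_Mapping.map.rep_eq when_def)
  then show ?thesis
    by (simp add: mult_map_scale_conv_mult flip: single_of_int)
qed

text \<open>Seen as elements of the free abelian group on words, polynomials are substituted into by
  additive extension. Linearity is then inherited, and multiplicativity has to be checked on words
  only, by \<open>frag_induction\<close>.\<close>

lemma nc_subst_eq_frag_extend:
  "nc_subst f = frag_extend (\<lambda>w. prod_list (map f (letters w)))"
  by (rule ext) (simp add: nc_subst_def frag_extend_def frag_cmul_conv_mult)

lemma nc_subst_0 [simp]: "nc_subst f 0 = 0"
  and nc_subst_add: "nc_subst f (p + q) = nc_subst f p + nc_subst f q"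
  and nc_subst_diff: "nc_subst f (p - q) = nc_subst f p - nc_subst f q"
  and nc_subst_sum: "finite I \<Longrightarrow> nc_subst f (\<Sum>i\<in>I. g i) = (\<Sum>i\<in>I. nc_subst f (g i))"
  by (simp_all add: nc_subst_eq_frag_extend frag_extend_add frag_extend_diff frag_extend_sum o_def)

lemma nc_subst_monomial [simp]:
  "nc_subst f (frag_of w) = prod_list (map f (letters w))"
  by (simp add: nc_subst_eq_frag_extend)

lemma nc_subst_1 [simp]: "nc_subst f 1 = 1"
  using nc_subst_monomial[of f 0] by (simp add: zero_nc_word_def[symmetric]) (simp add: zero_nc_word_def)

lemma nc_subst_var [simp]: "nc_subst f (nc_var x) = f x"
  by (simp add: nc_var_def)

lemma nc_subst_mult: "nc_subst f (p * q) = nc_subst f p * nc_subst f q"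
proof (induction p rule: frag_induction[OF subset_UNIV])
  case 1
  show ?case by simp
next
  case (2 v)
  show ?case
  proof (induction q rule: frag_induction[OF subset_UNIV])
    case 1
    show ?case by simp
  next
    case (2 w)
    show ?case by (simp add: mult_single plus_nc_word_def)
  next
    case (3 a b)
    then show ?case by (simp add: right_diff_distrib nc_subst_diff)
  qed
next
  case (3 a b)
  then show ?case by (simp add: left_diff_distrib nc_subst_diff)
qed

lemma nc_subst_of_int [simp]: "nc_subst f (of_int k) = of_int k"
  using nc_subst_eq_frag_extend[of f] frag_extend_cmul[of "\<lambda>w. prod_list (map f (letters w))" k 1]
  by (metis frag_cmul_conv_mult mult.right_neutral nc_subst_1)


section \<open>Coefficients of cd-words expanded in a and b\<close>

lemma lookup_var_mult_Nil [simp]: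
  "Poly_Mapping.lookup (nc_var x * p) (NC_Word []) = 0"
proof (induction p rule: frag_induction[OF subset_UNIV])
  case (2 v)
  then show ?case by (simp add: nc_var_def mult_single plus_nc_word_def lookup_single)
qed (simp_all add: right_diff_distrib lookup_minus)

lemma lookup_var_mult_Cons [simp]:
  "Poly_Mapping.lookup (nc_var x * p) (NC_Word (y # ys)) =
     (if x = y then Poly_Mapping.lookup p (NC_Word ys) else 0)"
proof (induction p rule: frag_induction[OF subset_UNIV])
  case (2 v)
  then show ?case
    by (cases v) (simp add: nc_var_def mult_single plus_nc_word_def lookup_single when_def)
qed (simp_all add: right_diff_distrib lookup_minus)

definition cd_coeff :: "cd list \<Rightarrow> ab list \<Rightarrow> int" where
  "cd_coeff v w = Poly_Mapping.lookup (prod_list (map cd_to_ab v)) (NC_Word w)"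

text \<open>A \<open>C\<close> matches any single letter and a \<open>D\<close> any two different
  letters, so expanding a cd-word amounts to matching it against an ab-word from the left, and every
  coefficient is 0 or 1.\<close>

lemma cd_coeff_simps:
  "cd_coeff [] w = (if w = [] then 1 else 0)"
  "cd_coeff (C # v) [] = 0"
  "cd_coeff (C # v) (x # w) = cd_coeff v w"
  "cd_coeff (D # v) [] = 0"
  "cd_coeff (D # v) [x] = 0"
  "cd_coeff (D # v) (x # y # w) = (if x \<noteq> y then cd_coeff v w else 0)"
  by (cases x; cases y; auto simp: cd_coeff_def lookup_one when_def zero_nc_word_def distrib_right lookup_add mult.assoc)+

lemma lookup_nc_subst_cd:
  "Poly_Mapping.lookup (nc_subst cd_to_ab p) (NC_Word w) =
     (\<Sum>v | Poly_Mapping.lookup p (NC_Word v) \<noteq> 0.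
        Poly_Mapping.lookup p (NC_Word v) * cd_coeff v w)"
proof -
  have *: "bij_betw letters (Poly_Mapping.keys p) {v. Poly_Mapping.lookup p (NC_Word v) \<noteq> 0}"
    by (rule bij_betw_byWitness[where f' = NC_Word]) (auto simp: in_keys_iff)
  have "Poly_Mapping.lookup (nc_subst cd_to_ab p) (NC_Word w) =
      (\<Sum>v\<in>Poly_Mapping.keys p. Poly_Mapping.lookup p v * cd_coeff (letters v) w)"
    by (simp add: nc_subst_eq_frag_extend frag_extend_def lookup_sum cd_coeff_def)
  also have "\<dots> = (\<Sum>v | Poly_Mapping.lookup p (NC_Word v) \<noteq> 0.
        Poly_Mapping.lookup p (NC_Word v) * cd_coeff v w)"
    by (subst sum.reindex_bij_betw[OF *, symmetric]) simp
  finally show ?thesis .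
qed

text \<open>The \<open>c\<close>-part and the \<open>d\<close>-part of a polynomial are separated by the words starting with
  \<open>aa\<close>, \<open>bb\<close> (only \<open>c\<close> contributes) and \<open>ab\<close>.\<close>

lemma cd_coeff_divisible:
  fixes g :: "cd list \<Rightarrow> int"
  assumes "finite {v. g v \<noteq> 0}" and "\<And>v. g v \<noteq> 0 \<Longrightarrow> length v < n"
    and "\<And>w. k dvd (\<Sum>v | g v \<noteq> 0. g v * cd_coeff v w)"
  shows "k dvd g v"
  using assms
proof (induction n arbitrary: g v)
  case 0
  then show ?case by (metis dvd_0_right less_nat_zero_code)
next
  case (Suc n)
  define gC where "gC v = g (C # v)" for v
  define gD where "gD v = g (D # v)" for v
  have fin: "finite {v. gC v \<noteq> 0}" "finite {v. gD v \<noteq> 0}"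
    using finite_vimageI[OF Suc.prems(1), of "(#) C"] finite_vimageI[OF Suc.prems(1), of "(#) D"]
    by (simp_all add: gC_def gD_def vimage_def)
  have split: "(\<Sum>v | g v \<noteq> 0. g v * cd_coeff v w) =
      g [] * cd_coeff [] w + (\<Sum>v | gC v \<noteq> 0. gC v * cd_coeff (C # v) w) +
      (\<Sum>v | gD v \<noteq> 0. gD v * cd_coeff (D # v) w)" for w
  proof -
    let ?f = "\<lambda>v. g v * cd_coeff v w"
    let ?S = "insert [] ((#) C ` {v. gC v \<noteq> 0} \<union> (#) D ` {v. gD v \<noteq> 0})"
    have sub: "{v. g v \<noteq> 0} \<subseteq> ?S"
    proof
      fix v assume "v \<in> {v. g v \<noteq> 0}"
      then show "v \<in> ?S"
        by (cases v rule: list.exhaust; cases "hd v") (auto simp: gC_def gD_def)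
    qed
    have "(\<Sum>v | g v \<noteq> 0. ?f v) = sum ?f ?S"
      by (rule sum.mono_neutral_left) (use fin sub in auto)
    also have "\<dots> = ?f [] + (sum ?f ((#) C ` {v. gC v \<noteq> 0}) + sum ?f ((#) D ` {v. gD v \<noteq> 0}))"
      using fin by (subst sum.insert) (auto intro!: sum.union_disjoint)
    finally show ?thesis
      by (simp add: sum.reindex gC_def gD_def add.assoc)
  qed
  note dv = Suc.prems(3)[unfolded split]
  have g0: "k dvd g []"
    using dv[of "[]"] by (simp add: cd_coeff_simps)
  have gC: "k dvd gC v" for v
  proof (rule Suc.IH)
    fix w
    show "k dvd (\<Sum>v | gC v \<noteq> 0. gC v * cd_coeff v w)"
    proof (cases w)
      case Nil
      then show ?thesis using dv[of "[A]"] by (simp add: cd_coeff_simps)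
    next
      case (Cons x w')
      then show ?thesis using dv[of "x # x # w'"] by (simp add: cd_coeff_simps)
    qed
  qed (use fin Suc.prems(2) in \<open>force simp: gC_def\<close>)+
  have gD: "k dvd gD v" for v
  proof (rule Suc.IH)
    fix w
    \<comment> \<open>Both parts contribute to the word \<open>A # B # w\<close>; the contribution
      of \<open>C\<close> is divisible by \<open>gC\<close>, hence so is that of
      \<open>D\<close>.\<close>
    have "k dvd (\<Sum>v | gC v \<noteq> 0. gC v * cd_coeff v (B # w))"
      by (intro dvd_sum dvd_mult2 gC)
    then show "k dvd (\<Sum>v | gD v \<noteq> 0. gD v * cd_coeff v w)"
      using dv[of "A # B # w"] by (simp add: cd_coeff_simps dvd_add_right_iff)
  qed (use fin Suc.prems(2) in \<open>force simp: gD_def\<close>)+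
  show ?case
    using g0 gC gD by (cases v rule: list.exhaust; cases "hd v") (auto simp: gC_def gD_def)
qed

text \<open>One statement with two uses: \<open>k = 0\<close> gives injectivity, as only 0 is
  divisible by 0, and \<open>k = 2\<close> allows a preimage of a doubled polynomial to be
  halved.\<close>

lemma nc_subst_cd_divisible:
  assumes "\<And>w. k dvd Poly_Mapping.lookup (nc_subst cd_to_ab p) w"
  shows "k dvd Poly_Mapping.lookup p v"
proof -
  let ?g = "\<lambda>v. Poly_Mapping.lookup p (NC_Word v)"
  have fin: "finite {v. ?g v \<noteq> 0}"
    using finite_imageI[OF finite_keys[of p], of letters]
    by (rule finite_subset[rotated]) (force simp: in_keys_iff)
  obtain n where "\<And>v. ?g v \<noteq> 0 \<Longrightarrow> length v < n"
    using finite_nat_set_iff_bounded[of "length ` {v. ?g v \<noteq> 0}"] fin by auto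
  then have "k dvd ?g u" for u
    using assms by (intro cd_coeff_divisible[OF fin]) (simp_all flip: lookup_nc_subst_cd)
  then show ?thesis by (metis nc_word.exhaust)
qed

lemma inj_nc_subst_cd: "inj (nc_subst cd_to_ab)"
proof (rule injI)
  fix p q assume "nc_subst cd_to_ab p = nc_subst cd_to_ab q"
  then have "0 dvd Poly_Mapping.lookup (p - q) v" for v
    by (intro nc_subst_cd_divisible) (simp add: nc_subst_diff)
  then show "p = q"
    by (intro poly_mapping_eqI) (simp add: lookup_minus)
qed

section \<open>The subring of cd-polynomials\<close>

definition is_cd_poly :: "ab nc_poly \<Rightarrow> bool" where
  "is_cd_poly p \<longleftrightarrow> p \<in> range (nc_subst cd_to_ab)"

lemma is_cd_poly_simps:
  "is_cd_poly 0" "is_cd_poly 1" "is_cd_poly (of_int k)"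
  "is_cd_poly (nc_var A + nc_var B)"
  "is_cd_poly (nc_var A * nc_var B + nc_var B * nc_var A)"
  unfolding is_cd_poly_def
  using rangeI[of "nc_subst cd_to_ab" 0] rangeI[of "nc_subst cd_to_ab" 1]
    rangeI[of "nc_subst cd_to_ab" "of_int k"] rangeI[of "nc_subst cd_to_ab" "nc_var C"]
    rangeI[of "nc_subst cd_to_ab" "nc_var D"]
  by simp_all

lemma is_cd_poly_arith:
  assumes "is_cd_poly p" "is_cd_poly q"
  shows "is_cd_poly (p + q)" "is_cd_poly (p - q)" "is_cd_poly (p * q)"
  using assms unfolding is_cd_poly_def
  by (auto simp flip: nc_subst_add nc_subst_diff nc_subst_mult)

lemma is_cd_poly_sum: "(\<And>i. i \<in> I \<Longrightarrow> is_cd_poly (f i)) \<Longrightarrow> is_cd_poly (sum f I)"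
  by (induction I rule: infinite_finite_induct) (auto intro: is_cd_poly_simps is_cd_poly_arith)

text \<open>A preimage of \<open>p + p\<close> has even coefficients, and half of it is a preimage
  of \<open>p\<close>.\<close>

lemma is_cd_poly_double:
  assumes "is_cd_poly (p + p)"
  shows "is_cd_poly p"
proof -
  obtain q where q: "nc_subst cd_to_ab q = p + p"
    using assms by (auto simp: is_cd_poly_def)
  have even: "2 dvd Poly_Mapping.lookup q v" for v
    by (rule nc_subst_cd_divisible) (simp add: q lookup_add)
  define q' where "q' = Poly_Mapping.map (\<lambda>x. x div 2) q"
  have "q = q' + q'"
  proof (rule poly_mapping_eqI)
    fix v show "Poly_Mapping.lookup q v = Poly_Mapping.lookup (q' + q') v"
      using even[of v] by (auto simp: q'_def Poly_Mapping.map.rep_eq when_def lookup_add)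
  qed
  then have *: "nc_subst cd_to_ab q' + nc_subst cd_to_ab q' = p + p"
    using q by (simp add: nc_subst_add)
  have "nc_subst cd_to_ab q' = p"
  proof (rule poly_mapping_eqI)
    fix w show "Poly_Mapping.lookup (nc_subst cd_to_ab q') w = Poly_Mapping.lookup p w"
      using arg_cong[OF *, of "\<lambda>p. Poly_Mapping.lookup p w"] by (simp add: lookup_add)
  qed
  then show ?thesis by (auto simp: is_cd_poly_def)
qed

lemma nc_subst_cd_index:
  assumes "is_cd_poly (ab_index r)"
  shows "nc_subst cd_to_ab (cd_index r) = ab_index r"
proof -
  obtain p where p: "nc_subst cd_to_ab p = ab_index r"
    using assms by (auto simp: is_cd_poly_def)
  show ?thesis
    unfolding cd_index_def
    by (rule theI[of _ p]) (use p inj_nc_subst_cd in \<open>auto simp: inj_def\<close>)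
qed

section \<open>Chain expansions in ranked posets\<close>

abbreviation av :: "ab nc_poly" where "av \<equiv> nc_var A"
abbreviation bv :: "ab nc_poly" where "bv \<equiv> nc_var B"

definition open_interval :: "'a rel \<Rightarrow> 'a \<Rightarrow> 'a \<Rightarrow> 'a set" where
  "open_interval r s t = {z. (s, z) \<in> r \<and> (z, t) \<in> r \<and> z \<noteq> s \<and> z \<noteq> t}"

text \<open>The chain expansion of the ab-index of the interval from \<open>s\<close> to \<open>t\<close>, sorted by the largest
  element of the chain. The condition \<open>\<rho> z < \<rho> t\<close> only serves termination.\<close>

function psi :: "'a rel \<Rightarrow> ('a \<Rightarrow> nat) \<Rightarrow> 'a \<Rightarrow> 'a \<Rightarrow> ab nc_poly" where
  "psi r \<rho> s t = (av - bv) ^ (\<rho> t - \<rho> s - 1) +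
     (\<Sum>z\<in>{z \<in> open_interval r s t. \<rho> z < \<rho> t}. psi r \<rho> s z * bv * (av - bv) ^ (\<rho> t - \<rho> z - 1))"
  by auto
termination by (relation "measure (\<lambda>(r, \<rho>, s, t). \<rho> t)") auto

declare psi.simps [simp del]

text \<open>The final letter \<open>b\<close> records \<open>x\<close> itself. The lower endpoint
  \<open>s\<close> is recorded by no letter, so its weight 1 stands for the empty chain, which makes
  the two terms of the right recursion a single sum.\<close>

definition chain_weight :: "'a rel \<Rightarrow> ('a \<Rightarrow> nat) \<Rightarrow> 'a \<Rightarrow> 'a \<Rightarrow> ab nc_poly" where
  "chain_weight r \<rho> s x = (if x = s then 1 else psi r \<rho> s x * bv)"

locale ranked_poset =
  fixes r :: "'a rel" and \<rho> :: "'a \<Rightarrow> nat"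
  assumes finite_rel: "finite r"
    and partial_order: "Partial_order r"
    and rank_less: "(x, y) \<in> r \<Longrightarrow> x \<noteq> y \<Longrightarrow> \<rho> x < \<rho> y"
begin

lemma le_refl: "(x, y) \<in> r \<Longrightarrow> (x, x) \<in> r \<and> (y, y) \<in> r"
  using partial_order by (auto simp: order_on_defs refl_on_def Field_def)

lemma le_trans: "(x, y) \<in> r \<Longrightarrow> (y, z) \<in> r \<Longrightarrow> (x, z) \<in> r"
  using partial_order by (auto simp: order_on_defs trans_def)

lemma antisym: "(x, y) \<in> r \<Longrightarrow> (y, x) \<in> r \<Longrightarrow> x = y"
  using partial_order by (auto simp: order_on_defs antisym_def)

lemma rank_le: "(x, y) \<in> r \<Longrightarrow> \<rho> x \<le> \<rho> y"
  using rank_less by (cases "x = y") (auto intro: less_imp_le)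

lemma finite_Field: "finite (Field r)"
  by (simp add: finite_Field finite_rel)

lemma finite_up: "finite {z. (x, z) \<in> r \<and> Q z}"
  by (auto intro: finite_subset[OF _ finite_Field] simp: FieldI1 FieldI2)

lemma finite_open_interval: "finite (open_interval r s t)"
  using finite_up by (simp add: open_interval_def)

lemma psi_right:
  "psi r \<rho> s t = (av - bv) ^ (\<rho> t - \<rho> s - 1) +
     (\<Sum>z\<in>open_interval r s t. psi r \<rho> s z * bv * (av - bv) ^ (\<rho> t - \<rho> z - 1))"
  using rank_less by (subst psi.simps) (auto simp: open_interval_def intro!: sum.cong)

lemma psi_chain_weight:
  assumes "(s, t) \<in> r" "s \<noteq> t"
  shows "psi r \<rho> s t = (\<Sum>z | (s, z) \<in> r \<and> (z, t) \<in> r \<and> z \<noteq> t.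
    chain_weight r \<rho> s z * (av - bv) ^ (\<rho> t - \<rho> z - 1))"
proof -
  have "{z. (s, z) \<in> r \<and> (z, t) \<in> r \<and> z \<noteq> t} = insert s (open_interval r s t)"
    using assms le_refl by (auto simp: open_interval_def)
  then show ?thesis
    using finite_open_interval[of s t]
    by (simp add: psi_right[of s t] chain_weight_def open_interval_def cong: if_cong)
qed

lemma sum_open_interval_swap:
  "(\<Sum>z\<in>open_interval r s t. \<Sum>y\<in>open_interval r s z. f y z) =
   (\<Sum>y\<in>open_interval r s t. \<Sum>z\<in>open_interval r y t. f y z)"
proof -
  let ?I = "open_interval r s t"
  have 1: "open_interval r s z = {y \<in> ?I. (y, z) \<in> r \<and> y \<noteq> z}" if "z \<in> ?I" for z
    using that by (auto simp: open_interval_def dest: le_trans antisym)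
  have 2: "open_interval r y t = {z \<in> ?I. (y, z) \<in> r \<and> y \<noteq> z}" if "y \<in> ?I" for y
    using that by (auto simp: open_interval_def dest: le_trans antisym)
  have "(\<Sum>z\<in>?I. \<Sum>y\<in>open_interval r s z. f y z) =
      (\<Sum>z\<in>?I. \<Sum>y | y \<in> ?I \<and> (y, z) \<in> r \<and> y \<noteq> z. f y z)"
    by (rule sum.cong[OF refl]) (simp only: 1)
  also have "\<dots> = (\<Sum>y\<in>?I. \<Sum>z | z \<in> ?I \<and> (y, z) \<in> r \<and> y \<noteq> z. f y z)"
    by (rule sum.swap_restrict) (rule finite_open_interval)+
  also have "\<dots> = (\<Sum>y\<in>?I. \<Sum>z\<in>open_interval r y t. f y z)"
    by (rule sum.cong[OF refl]) (simp only: 2)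
  finally show ?thesis .
qed

text \<open>Expanding each \<open>psi r \<rho> s z\<close> in the right recursion by induction gives
  a sum over pairs \<open>y\<close> below \<open>z\<close>. Once the order of summation is
  exchanged, the sum over \<open>z\<close> for fixed \<open>y\<close> is the right recursion for
  \<open>psi r \<rho> y t\<close>.\<close>

lemma psi_left:
  "psi r \<rho> s t = (av - bv) ^ (\<rho> t - \<rho> s - 1) +
     (\<Sum>z\<in>open_interval r s t. (av - bv) ^ (\<rho> z - \<rho> s - 1) * bv * psi r \<rho> z t)"
proof (induction "\<rho> t" arbitrary: t rule: less_induct)
  case less
  let ?e = "\<lambda>x y. (av - bv) ^ (\<rho> y - \<rho> x - 1)"
  have IH: "psi r \<rho> s z = ?e s z + (\<Sum>y\<in>open_interval r s z. ?e s y * bv * psi r \<rho> y z)"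
    if "z \<in> open_interval r s t" for z
    using less that rank_less by (auto simp: open_interval_def)
  have inner: "?e y t + (\<Sum>z\<in>open_interval r y t. psi r \<rho> y z * bv * ?e z t) = psi r \<rho> y t" for y
    by (rule psi_right[symmetric])
  have "psi r \<rho> s t = ?e s t + (\<Sum>z\<in>open_interval r s t. ?e s z * bv * ?e z t) +
      (\<Sum>z\<in>open_interval r s t. \<Sum>y\<in>open_interval r s z. ?e s y * bv * psi r \<rho> y z * bv * ?e z t)"
    by (subst psi_right) (simp add: IH distrib_right sum.distrib sum_distrib_right add.assoc)
  also have "\<dots> = ?e s t + (\<Sum>y\<in>open_interval r s t. ?e s y * bv *
      (?e y t + (\<Sum>z\<in>open_interval r y t. psi r \<rho> y z * bv * ?e z t)))"
    by (simp add: sum_open_interval_swap sum.distrib sum_distrib_left distrib_left mult.assoc)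
  also have "\<dots> = ?e s t + (\<Sum>y\<in>open_interval r s t. ?e s y * bv * psi r \<rho> y t)"
    by (rule arg_cong[OF sum.cong[OF refl arg_cong[OF inner]]])
  finally show ?case .
qed

text \<open>Only the elements between \<open>s\<close> and \<open>t\<close> matter, so
  \<open>f\<close> has to embed a set \<open>S\<close> containing them and to hit everything between
  their images. Ranks may differ by a constant; the condition is additive to avoid truncated
  subtraction.\<close>

lemma psi_embedding:
  fixes r' :: "'b rel" and \<rho>' :: "'b \<Rightarrow> nat"
  assumes "ranked_poset r' \<rho>'"
    and iff: "\<And>x y. x \<in> S \<Longrightarrow> y \<in> S \<Longrightarrow> (f x, f y) \<in> r' \<longleftrightarrow> (x, y) \<in> r"
    and closed: "\<And>x y. y \<in> S \<Longrightarrow> (s, x) \<in> r \<Longrightarrow> (x, y) \<in> r \<Longrightarrow> x \<in> S"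
    and image: "\<And>y z. y \<in> S \<Longrightarrow> (f s, z) \<in> r' \<Longrightarrow> (z, f y) \<in> r' \<Longrightarrow> z \<in> f ` S"
    and rank: "\<And>x. x \<in> S \<Longrightarrow> (s, x) \<in> r \<Longrightarrow> \<rho>' (f x) + \<rho> s = \<rho> x + \<rho>' (f s)"
    and t: "t \<in> S" "(s, t) \<in> r"
  shows "psi r' \<rho>' (f s) (f t) = psi r \<rho> s t"
  using t
proof (induction "\<rho> t" arbitrary: t rule: less_induct)
  case less
  interpret r': ranked_poset r' \<rho>' by fact
  have s: "s \<in> S" using closed[OF less.prems(1) _ less.prems(2)] le_refl[OF less.prems(2)] by simp
  have inj: "x = y" if "x \<in> S" "y \<in> S" "(x, x) \<in> r" "f x = f y" for x y
    using that(3,4) iff[OF that(1,1)] iff[OF that(1,2)] iff[OF that(2,1)] antisym[of x y] by simp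
  have bij: "bij_betw f (open_interval r s t) (open_interval r' (f s) (f t))"
  proof (rule bij_betw_imageI)
    show "inj_on f (open_interval r s t)"
    proof (rule inj_onI)
      fix x y assume *: "x \<in> open_interval r s t" "y \<in> open_interval r s t" "f x = f y"
      then have "x \<in> S" "y \<in> S" "(x, x) \<in> r"
        using closed[OF less.prems(1)] le_refl by (auto simp: open_interval_def)
      with * show "x = y" using inj by simp
    qed
    have "z \<in> f ` open_interval r s t" if z: "z \<in> open_interval r' (f s) (f t)" for z
    proof -
      obtain x where x: "x \<in> S" "z = f x"
        using z image[OF less.prems(1)] by (auto simp: open_interval_def)
      then show ?thesis
        using z iff s less.prems by (auto simp: open_interval_def)
    qed
    moreover have "f x \<in> open_interval r' (f s) (f t)" if x: "x \<in> open_interval r s t" for x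
    proof -
      have "x \<in> S" using x closed less.prems by (auto simp: open_interval_def)
      moreover have "(x, x) \<in> r" "(s, s) \<in> r"
        using x le_refl by (auto simp: open_interval_def)
      ultimately show ?thesis
        using x iff s less.prems inj[of x t] inj[of s x] by (auto simp: open_interval_def)
    qed
    ultimately show "f ` open_interval r s t = open_interval r' (f s) (f t)" by blast
  qed
  have "psi r' \<rho>' (f s) (f t) = (av - bv) ^ (\<rho>' (f t) - \<rho>' (f s) - 1) +
     (\<Sum>x\<in>open_interval r s t. psi r' \<rho>' (f s) (f x) * bv * (av - bv) ^ (\<rho>' (f t) - \<rho>' (f x) - 1))"
    unfolding r'.psi_right[of "f s" "f t"]
    by (rule arg_cong[OF sum.reindex_bij_betw[OF bij, symmetric]])
  also have "\<dots> = psi r \<rho> s t"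
  proof -
    have "psi r' \<rho>' (f s) (f x) * bv * (av - bv) ^ (\<rho>' (f t) - \<rho>' (f x) - 1) =
        psi r \<rho> s x * bv * (av - bv) ^ (\<rho> t - \<rho> x - 1)" if "x \<in> open_interval r s t" for x
    proof -
      have x: "(s, x) \<in> r" "(x, t) \<in> r" "x \<noteq> t" "x \<in> S"
        using that closed less.prems by (auto simp: open_interval_def)
      have "psi r' \<rho>' (f s) (f x) = psi r \<rho> s x"
        using x less.hyps rank_less by blast
      moreover have "\<rho>' (f t) - \<rho>' (f x) - 1 = \<rho> t - \<rho> x - 1"
        using rank[OF less.prems] rank[OF x(4,1)] by simp
      ultimately show ?thesis by metis
    qed
    moreover have "\<rho>' (f t) - \<rho>' (f s) - 1 = \<rho> t - \<rho> s - 1"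
      using rank[OF less.prems] by simp
    ultimately show ?thesis
      unfolding psi_right[of s t] by (intro arg_cong2[of _ _ _ _ "(+)"] sum.cong) simp_all
  qed
  finally show ?case .
qed

end

section \<open>Existence of the cd-index\<close>

locale eulerian_ranked_poset = ranked_poset +
  assumes alternating_sum: "(s, t) \<in> r \<Longrightarrow> s \<noteq> t \<Longrightarrow> (\<Sum>z | (s, z) \<in> r \<and> (z, t) \<in> r. (- 1) ^ \<rho> z) = (0 :: int)"
begin

lemma alternating_sum_below:
  assumes "(s, t) \<in> r" "s \<noteq> t"
  shows "(\<Sum>z | (s, z) \<in> r \<and> (z, t) \<in> r \<and> z \<noteq> t. (- 1) ^ \<rho> z) = - ((- 1) ^ \<rho> t :: int)"
proof -
  have *: "{z. (s, z) \<in> r \<and> (z, t) \<in> r} = insert t {z. (s, z) \<in> r \<and> (z, t) \<in> r \<and> z \<noteq> t}"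
    using assms le_refl by auto
  show ?thesis
    using alternating_sum[OF assms] finite_up[of s "\<lambda>z. (z, t) \<in> r \<and> z \<noteq> t"]
    unfolding * by simp
qed

text \<open>The ab-index of the elements of rank below \<open>k\<close>, with a new top of rank \<open>k\<close>, where chains
  are weighted by \<open>h\<close> at their largest element. General weights make the induction on \<open>k\<close> work:
  the two truncations of an Eulerian weight are governed by another Eulerian weight, of rank \<open>k - 2\<close>.\<close>

definition weighted_index :: "'a \<Rightarrow> nat \<Rightarrow> ('a \<Rightarrow> int) \<Rightarrow> ab nc_poly" where
  "weighted_index s k h = (\<Sum>x | (s, x) \<in> r \<and> \<rho> x < k.
     of_int (h x) * chain_weight r \<rho> s x * (av - bv) ^ (k - 1 - \<rho> x))"

definition eulerian_weight :: "'a \<Rightarrow> nat \<Rightarrow> ('a \<Rightarrow> int) \<Rightarrow> bool" where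
  "eulerian_weight s k h \<longleftrightarrow> (\<forall>x. (s, x) \<in> r \<and> \<rho> x < k \<longrightarrow>
     (\<Sum>z | (x, z) \<in> r \<and> \<rho> z < k. h z * (- 1) ^ \<rho> z) = - ((- 1) ^ k * h x))"

text \<open>An interval is the case of an indicator weight. For \<open>x\<close> properly below
  \<open>t\<close> the weight condition is the Euler relation of the interval from \<open>x\<close>
  to \<open>t\<close> with the term of \<open>t\<close> moved to the right; for any other
  \<open>x\<close> both sides are 0.\<close>

lemma psi_weighted_index:
  assumes "(s, t) \<in> r" "s \<noteq> t"
  defines "h \<equiv> \<lambda>z. of_bool ((z, t) \<in> r \<and> z \<noteq> t)"
  shows "psi r \<rho> s t = weighted_index s (\<rho> t) h" and "eulerian_weight s (\<rho> t) h"
proof -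
  have *: "{z. (s, z) \<in> r \<and> (z, t) \<in> r \<and> z \<noteq> t} \<subseteq> {z. (s, z) \<in> r \<and> \<rho> z < \<rho> t}" for s
    using rank_less by auto
  show "psi r \<rho> s t = weighted_index s (\<rho> t) h"
    unfolding psi_chain_weight[OF assms(1,2)] weighted_index_def
    by (rule sum.mono_neutral_cong_left) (use * finite_up in \<open>auto simp: h_def diff_right_commute\<close>)
  show "eulerian_weight s (\<rho> t) h"
    unfolding eulerian_weight_def
  proof (intro allI impI)
    fix x assume x: "(s, x) \<in> r \<and> \<rho> x < \<rho> t"
    have "(\<Sum>z | (x, z) \<in> r \<and> \<rho> z < \<rho> t. h z * (- 1) ^ \<rho> z) =
        (\<Sum>z | (x, z) \<in> r \<and> (z, t) \<in> r \<and> z \<noteq> t. (- 1) ^ \<rho> z)"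
      by (rule sum.mono_neutral_cong_right) (use * finite_up in \<open>auto simp: h_def\<close>)
    also have "\<dots> = - ((- 1) ^ \<rho> t * h x)"
    proof (cases "(x, t) \<in> r")
      case True
      then show ?thesis using x alternating_sum_below[of x t] by (auto simp: h_def)
    next
      case False
      then have "{z. (x, z) \<in> r \<and> (z, t) \<in> r \<and> z \<noteq> t} = {}"
        using le_trans by blast
      with False show ?thesis by (simp only:) (simp add: h_def)
    qed
    finally show "(\<Sum>z | (x, z) \<in> r \<and> \<rho> z < \<rho> t. h z * (- 1) ^ \<rho> z) = - ((- 1) ^ \<rho> t * h x)" .
  qed
qed

text \<open>The step shows that twice the index is a cd-polynomial; here \<open>(a - b)\<^sup>2 = c\<^sup>2 - 2 d\<close> enters.\<close>

lemma weighted_index_step: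
  assumes "eulerian_weight s (Suc (Suc j)) h" "\<rho> s \<le> j"
  defines "h' \<equiv> \<lambda>z. (\<Sum>x | (z, x) \<in> r \<and> \<rho> x = Suc j. h x) - 2 * h z"
  defines "Y \<equiv> (\<Sum>x | (s, x) \<in> r \<and> \<rho> x = Suc j. of_int (h x) * psi r \<rho> s x)"
  defines "E \<equiv> weighted_index s (Suc (Suc j)) h" and "q \<equiv> weighted_index s j h'"
  shows "E + E = Y * (av + bv) -
      q * ((av + bv) * (av + bv) - ((av * bv + bv * av) + (av * bv + bv * av)))"
    and "eulerian_weight s j h'"
proof -
  define H where "H z = (\<Sum>x | (z, x) \<in> r \<and> \<rho> x = Suc j. h x)" for z
  define e where "e = av - bv"
  have h': "h' z = H z - 2 * h z" for z
    by (simp add: h'_def H_def)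
  note fin = finite_up
  \<comment> \<open>The weight condition with the elements of rank \<open>Suc j\<close>, whose
    weights add up to \<open>H x\<close>, moved to the right.\<close>
  have weight: "(\<Sum>z | (x, z) \<in> r \<and> \<rho> z < Suc j. h z * (- 1) ^ \<rho> z) = (- 1) ^ j * (H x - h x)"
    if x: "(s, x) \<in> r" "\<rho> x < Suc j" for x
  proof -
    have "{z. (x, z) \<in> r \<and> \<rho> z < Suc (Suc j)} =
        {z. (x, z) \<in> r \<and> \<rho> z < Suc j} \<union> {z. (x, z) \<in> r \<and> \<rho> z = Suc j}" by auto
    then have "(\<Sum>z | (x, z) \<in> r \<and> \<rho> z < Suc (Suc j). h z * (- 1) ^ \<rho> z) =
        (\<Sum>z | (x, z) \<in> r \<and> \<rho> z < Suc j. h z * (- 1) ^ \<rho> z) +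
        (\<Sum>z | (x, z) \<in> r \<and> \<rho> z = Suc j. h z * (- 1) ^ \<rho> z)"
      by (simp only:) (rule sum.union_disjoint; use fin in auto)
    also have "(\<Sum>z | (x, z) \<in> r \<and> \<rho> z = Suc j. h z * (- 1) ^ \<rho> z) = (- 1) ^ Suc j * H x"
      unfolding H_def sum_distrib_left by (rule sum.cong) auto
    finally show ?thesis
      using assms(1) x by (auto simp: eulerian_weight_def algebra_simps)
  qed
  \<comment> \<open>At rank \<open>j\<close> the sum in \<open>weight\<close> has \<open>z\<close>
    as its only term and forces \<open>H z = 2 * h z\<close>, a weighted form of the fact that
    intervals of length two have two middle elements. So \<open>h'\<close> lives on ranks below
    \<open>j\<close>, which is where two ranks are gained.\<close>
  have h'_top: "h' z = 0" if z: "(s, z) \<in> r" "\<rho> z = j" for z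
  proof -
    have "y = z" if "(z, y) \<in> r" "\<rho> y < Suc j" for y
      using rank_less[OF that(1)] that z by fastforce
    then have "{y. (z, y) \<in> r \<and> \<rho> y < Suc j} = {z}"
      using z le_refl[OF z(1)] by auto
    then show ?thesis
      using weight[of z] z by (simp add: h' power_add algebra_simps)
  qed
  have h'_sum: "(\<Sum>z | (x, z) \<in> r \<and> \<rho> z < j. g z (h' z)) = (\<Sum>z | (x, z) \<in> r \<and> \<rho> z < Suc j. g z (h' z))"
    if "(s, x) \<in> r" "\<And>z. g z 0 = 0" for x and g :: "'a \<Rightarrow> int \<Rightarrow> 'c :: comm_monoid_add"
    by (rule sum.mono_neutral_left) (use that fin h'_top le_trans in \<open>auto simp: less_Suc_eq\<close>)
  show "eulerian_weight s j h'"
    unfolding eulerian_weight_def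
  proof (intro allI impI)
    fix x assume "(s, x) \<in> r \<and> \<rho> x < j"
    then have x: "(s, x) \<in> r" "\<rho> x < Suc j" by auto
    \<comment> \<open>For each \<open>y\<close> of rank \<open>Suc j\<close> the elements from
      \<open>x\<close> up to but excluding \<open>y\<close> have alternating sum
      \<open>(- 1) ^ j\<close>. Subtracting twice \<open>weight\<close> then gives
      \<open>H x - 2 * (H x - h x) = - h' x\<close>, up to that sign.\<close>
    have "(\<Sum>z | (x, z) \<in> r \<and> \<rho> z < Suc j. H z * (- 1) ^ \<rho> z) =
        (\<Sum>z | (x, z) \<in> r \<and> \<rho> z < Suc j. \<Sum>y | (z, y) \<in> r \<and> \<rho> y = Suc j. h y * (- 1) ^ \<rho> z)"
      by (simp add: H_def sum_distrib_right)
    also have "\<dots> = (\<Sum>z | (x, z) \<in> r \<and> \<rho> z < Suc j.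
        \<Sum>y | y \<in> {y. (x, y) \<in> r \<and> \<rho> y = Suc j} \<and> (z, y) \<in> r. h y * (- 1) ^ \<rho> z)"
      using le_trans by (intro sum.cong refl) auto
    also have "\<dots> = (\<Sum>y | (x, y) \<in> r \<and> \<rho> y = Suc j.
        \<Sum>z | z \<in> {z. (x, z) \<in> r \<and> \<rho> z < Suc j} \<and> (z, y) \<in> r. h y * (- 1) ^ \<rho> z)"
      by (rule sum.swap_restrict) (use fin in auto)
    also have "\<dots> = (\<Sum>y | (x, y) \<in> r \<and> \<rho> y = Suc j. h y * (- 1) ^ j)"
    proof (rule sum.cong)
      fix y assume "y \<in> {y. (x, y) \<in> r \<and> \<rho> y = Suc j}"
      then have y: "(x, y) \<in> r" "\<rho> y = Suc j" "x \<noteq> y" using x by auto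
      have "{z. z \<in> {z. (x, z) \<in> r \<and> \<rho> z < Suc j} \<and> (z, y) \<in> r} =
          {z. (x, z) \<in> r \<and> (z, y) \<in> r \<and> z \<noteq> y}"
        using rank_less y by force
      then show "(\<Sum>z | z \<in> {z. (x, z) \<in> r \<and> \<rho> z < Suc j} \<and> (z, y) \<in> r. h y * (- 1) ^ \<rho> z) =
          h y * (- 1) ^ j"
        using alternating_sum_below[OF y(1,3)] y(2) by (simp flip: sum_distrib_left)
    qed simp
    finally have "(\<Sum>z | (x, z) \<in> r \<and> \<rho> z < Suc j. H z * (- 1) ^ \<rho> z) = (- 1) ^ j * H x"
      by (simp only: H_def sum_distrib_right[symmetric] mult.commute)
    moreover have "(\<Sum>z | (x, z) \<in> r \<and> \<rho> z < Suc j. h' z * (- 1) ^ \<rho> z) =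
       (\<Sum>z | (x, z) \<in> r \<and> \<rho> z < Suc j. H z * (- 1) ^ \<rho> z) -
       2 * (\<Sum>z | (x, z) \<in> r \<and> \<rho> z < Suc j. h z * (- 1) ^ \<rho> z)"
      by (simp add: h' sum_subtractf sum_distrib_left algebra_simps)
    ultimately show "(\<Sum>z | (x, z) \<in> r \<and> \<rho> z < j. h' z * (- 1) ^ \<rho> z) = - ((- 1) ^ j * h' x)"
      using weight[OF x] h'_sum[OF x(1), of "\<lambda>z c. c * (- 1) ^ \<rho> z"]
      by (simp add: h' algebra_simps)
  qed
  let ?W = "chain_weight r \<rho> s"
  define u where "u = (\<Sum>x | (s, x) \<in> r \<and> \<rho> x < Suc j. of_int (h x) * ?W x * e ^ (j - \<rho> x))"
  \<comment> \<open>The last letter says whether the chain contains an element of rank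
    \<open>Suc j\<close>: if not it is \<open>e\<close>, and if so it is \<open>b\<close>.\<close>
  have E: "E = u * e + Y * bv"
  proof -
    have "{x. (s, x) \<in> r \<and> \<rho> x < Suc (Suc j)} =
        {x. (s, x) \<in> r \<and> \<rho> x < Suc j} \<union> {x. (s, x) \<in> r \<and> \<rho> x = Suc j}" by auto
    then have "E = (\<Sum>x | (s, x) \<in> r \<and> \<rho> x < Suc j. of_int (h x) * ?W x * e ^ (Suc j - \<rho> x)) +
       (\<Sum>x | (s, x) \<in> r \<and> \<rho> x = Suc j. of_int (h x) * ?W x * e ^ (Suc j - \<rho> x))"
      unfolding E_def weighted_index_def e_def
      by (simp only: diff_Suc_1) (rule sum.union_disjoint; use fin in auto)
    also have "(\<Sum>x | (s, x) \<in> r \<and> \<rho> x < Suc j. of_int (h x) * ?W x * e ^ (Suc j - \<rho> x)) = u * e"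
      unfolding u_def sum_distrib_right
      by (rule sum.cong) (auto simp: mult.assoc Suc_diff_le simp flip: power_Suc2)
    also have "(\<Sum>x | (s, x) \<in> r \<and> \<rho> x = Suc j. of_int (h x) * ?W x * e ^ (Suc j - \<rho> x)) = Y * bv"
      unfolding Y_def sum_distrib_right
      by (rule sum.cong) (use assms(2) in \<open>auto simp: chain_weight_def mult.assoc\<close>)
    finally show ?thesis .
  qed
  \<comment> \<open>Sorting the chains in \<open>Y\<close> by their next largest element
    \<open>z\<close> shows that \<open>Y\<close> is the same kind of sum as \<open>u\<close>, with
    weight \<open>H\<close> for \<open>h\<close>. So \<open>Y - 2 u\<close> has weight
    \<open>h'\<close>, and its terms all end in \<open>e\<close>.\<close>
  have "Y = (\<Sum>x | (s, x) \<in> r \<and> \<rho> x = Suc j.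
      \<Sum>z | z \<in> {z. (s, z) \<in> r \<and> \<rho> z < Suc j} \<and> (z, x) \<in> r. of_int (h x) * (?W z * e ^ (j - \<rho> z)))"
    unfolding Y_def
  proof (rule sum.cong)
    fix x assume "x \<in> {x. (s, x) \<in> r \<and> \<rho> x = Suc j}"
    then have x: "(s, x) \<in> r" "\<rho> x = Suc j" "s \<noteq> x" using assms(2) by auto
    have "{z. z \<in> {z. (s, z) \<in> r \<and> \<rho> z < Suc j} \<and> (z, x) \<in> r} =
          {z. (s, z) \<in> r \<and> (z, x) \<in> r \<and> z \<noteq> x}"
      using rank_less x by force
    then show "of_int (h x) * psi r \<rho> s x =
        (\<Sum>z | z \<in> {z. (s, z) \<in> r \<and> \<rho> z < Suc j} \<and> (z, x) \<in> r. of_int (h x) * (?W z * e ^ (j - \<rho> z)))"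
      by (simp add: psi_chain_weight[OF x(1,3)] x(2) e_def sum_distrib_left)
  qed simp
  also have "\<dots> = (\<Sum>z | (s, z) \<in> r \<and> \<rho> z < Suc j.
      \<Sum>x | x \<in> {x. (s, x) \<in> r \<and> \<rho> x = Suc j} \<and> (z, x) \<in> r. of_int (h x) * (?W z * e ^ (j - \<rho> z)))"
    by (rule sum.swap_restrict) (use fin in auto)
  also have "\<dots> = (\<Sum>z | (s, z) \<in> r \<and> \<rho> z < Suc j. of_int (H z) * (?W z * e ^ (j - \<rho> z)))"
    unfolding H_def of_int_sum sum_distrib_right
    using le_trans by (intro sum.cong refl) auto
  finally have "Y - (u + u) = (\<Sum>z | (s, z) \<in> r \<and> \<rho> z < Suc j. of_int (h' z) * (?W z * e ^ (j - \<rho> z)))"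
    unfolding u_def
    by (simp add: h' mult.assoc left_diff_distrib sum_subtractf sum_distrib_left flip: mult_2)
  also have "\<dots> = (\<Sum>z | (s, z) \<in> r \<and> \<rho> z < j. of_int (h' z) * (?W z * e ^ (j - \<rho> z)))"
  proof (cases "\<exists>z. (s, z) \<in> r")
    case True
    then have "(s, s) \<in> r" using le_refl by blast
    then show ?thesis
      using h'_sum[of s "\<lambda>z c. of_int c * (?W z * e ^ (j - \<rho> z))"] by simp
  next
    case False
    then show ?thesis by simp
  qed
  also have "\<dots> = q * e"
    unfolding q_def weighted_index_def sum_distrib_right e_def[symmetric]
  proof (rule sum.cong)
    fix z assume "z \<in> {z. (s, z) \<in> r \<and> \<rho> z < j}"
    then have "j - \<rho> z = Suc (j - 1 - \<rho> z)" by auto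
    then show "of_int (h' z) * (?W z * e ^ (j - \<rho> z)) =
        of_int (h' z) * ?W z * e ^ (j - 1 - \<rho> z) * e"
      by (simp only: power_Suc2 mult.assoc)
  qed simp
  \<comment> \<open>Eliminating \<open>u\<close> from \<open>2 E = 2 u e + 2 Y b\<close> leaves
    \<open>Y (e + 2 b) - q e e\<close>, where \<open>e + 2 b = a + b\<close>.\<close>
  finally have Y: "Y = u + u + q * e" by (simp add: algebra_simps)
  show "E + E = Y * (av + bv) -
      q * ((av + bv) * (av + bv) - ((av * bv + bv * av) + (av * bv + bv * av)))"
    unfolding E Y e_def by (simp add: algebra_simps)
qed

lemma is_cd_poly_weighted_index:
  assumes "(s, s) \<in> r" "eulerian_weight s k h"
  shows "is_cd_poly (weighted_index s k h)"
  using assms(2)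
proof (induction k arbitrary: h rule: less_induct)
  case (less k)
  consider "k \<le> \<rho> s" | "k = Suc (\<rho> s)" | j where "k = Suc (Suc j)" "\<rho> s \<le> j"
    by (metis le_SucE not_less_eq_eq old.nat.exhaust zero_le)
  then show ?case
  proof cases
    case 1
    then have "{x. (s, x) \<in> r \<and> \<rho> x < k} = {}"
      using rank_le[of s] by (auto simp: not_less dest: order_trans)
    then show ?thesis by (simp only: weighted_index_def sum.empty is_cd_poly_simps)
  next
    case 2
    have "x = s" if "(s, x) \<in> r" "\<rho> x < k" for x
      using rank_less[OF that(1)] that 2 by fastforce
    then have "{x. (s, x) \<in> r \<and> \<rho> x < k} = {s}"
      using assms(1) 2 by auto
    then show ?thesis
      by (simp only: weighted_index_def) (simp add: is_cd_poly_simps chain_weight_def 2)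
  next
    case 3
    \<comment> \<open>The summands of \<open>Y\<close> are weighted indices of rank
      \<open>Suc j\<close>, below \<open>k\<close>, so the same induction covers them.\<close>
    have psi: "is_cd_poly (psi r \<rho> s x)" if "(s, x) \<in> r" "\<rho> x = Suc j" for x
    proof -
      have "s \<noteq> x" using that 3 by auto
      from psi_weighted_index[OF that(1) this] show ?thesis
        using less.IH that 3 by simp
    qed
    note step = weighted_index_step[OF less.prems[unfolded 3(1)] 3(2)]
    have "is_cd_poly (weighted_index s k h + weighted_index s k h)"
      unfolding 3(1) step(1)
      by (intro is_cd_poly_arith is_cd_poly_sum is_cd_poly_simps psi less.IH step(2)) (use 3 in auto)
    then show ?thesis by (rule is_cd_poly_double)
  qed
qed

lemma is_cd_poly_psi:
  assumes "(s, t) \<in> r" "s \<noteq> t"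
  shows "is_cd_poly (psi r \<rho> s t)"
  unfolding psi_weighted_index(1)[OF assms]
  by (rule is_cd_poly_weighted_index[OF _ psi_weighted_index(2)[OF assms]])
    (use le_refl[OF assms(1)] in simp)

end

section \<open>The ab-index as a chain expansion\<close>

lemma ex_max_rank:
  fixes \<rho> :: "'a \<Rightarrow> nat"
  assumes "finite Y" "Y \<noteq> {}"
  obtains y where "y \<in> Y" "\<And>k. k \<in> Y \<Longrightarrow> \<rho> k \<le> \<rho> y"
  using Max_in[of "\<rho> ` Y"] Max_ge[of "\<rho> ` Y"] assms by fastforce

lemma rank_function_less:
  assumes "finite r" "Partial_order r" "rank_function r \<rho>" "(x, y) \<in> r" "x \<noteq> y"
  shows "\<rho> x < \<rho> y"
  using assms(4,5)
proof (induction "card {z. (x, z) \<in> r \<and> (z, y) \<in> r}" arbitrary: x y rule: less_induct)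
  case less
  show ?case
  proof (cases "covers r x y")
    case True
    then show ?thesis using assms(3) by (auto simp: rank_function_def)
  next
    case False
    have trans: "(u, w) \<in> r" if "(u, v) \<in> r" "(v, w) \<in> r" for u v w
      using that assms(2) by (auto simp: order_on_defs trans_def)
    have refl: "(u, u) \<in> r" "(v, v) \<in> r" if "(u, v) \<in> r" for u v
      using that assms(2) by (auto simp: order_on_defs refl_on_def Field_def)
    have antisym: "u = v" if "(u, v) \<in> r" "(v, u) \<in> r" for u v
      using that assms(2) by (auto simp: order_on_defs antisym_def)
    obtain z where z: "(x, z) \<in> r" "(z, y) \<in> r" "z \<noteq> x" "z \<noteq> y"
      using False less.prems by (auto simp: covers_def)
    have fin: "finite {z. (x, z) \<in> r \<and> (z, y) \<in> r}"
      by (rule finite_subset[OF _ finite_Field[OF assms(1)]]) (auto simp: FieldI2)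
    have "\<rho> x < \<rho> z"
    proof (rule less.hyps)
      show "card {w. (x, w) \<in> r \<and> (w, z) \<in> r} < card {z. (x, z) \<in> r \<and> (z, y) \<in> r}"
      proof (rule psubset_card_mono[OF fin])
        have "y \<notin> {w. (x, w) \<in> r \<and> (w, z) \<in> r}" using antisym z by auto
        then show "{w. (x, w) \<in> r \<and> (w, z) \<in> r} \<subset> {z. (x, z) \<in> r \<and> (z, y) \<in> r}"
          using less.prems(1) refl(2)[OF less.prems(1)] trans[OF _ z(2)] by blast
      qed
    qed (use z in auto)
    also have "\<rho> z < \<rho> y"
    proof (rule less.hyps)
      show "card {w. (z, w) \<in> r \<and> (w, y) \<in> r} < card {z. (x, z) \<in> r \<and> (z, y) \<in> r}"
      proof (rule psubset_card_mono[OF fin])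
        have "x \<notin> {w. (z, w) \<in> r \<and> (w, y) \<in> r}" using antisym z by auto
        then show "{w. (z, w) \<in> r \<and> (w, y) \<in> r} \<subset> {z. (x, z) \<in> r \<and> (z, y) \<in> r}"
          using less.prems(1) refl(1)[OF less.prems(1)] trans[OF z(1)] by blast
      qed
    qed (use z in auto)
    finally show ?thesis .
  qed
qed

locale graded_ranked_poset =
  fixes r :: "'a rel" and \<rho> :: "'a \<Rightarrow> nat"
  assumes finite_rel: "finite r" and partial_order: "Partial_order r"
    and rank_function: "rank_function r \<rho>"

sublocale graded_ranked_poset \<subseteq> ranked_poset
  by unfold_locales
    (rule finite_rel partial_order rank_function_less[OF finite_rel partial_order rank_function]; assumption?)+

lemma graded_poset_ranked:
  assumes "graded_poset r"
  shows "graded_ranked_poset r (rk r)"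
  using assms someI_ex[of "rank_function r"]
  by (auto simp: graded_poset_def rk_def graded_ranked_poset_def)

context graded_ranked_poset
begin

lemma graded: "graded_poset r"
  using finite_rel partial_order rank_function by (auto simp: graded_poset_def)

lemma rank_covers: "covers r x y \<Longrightarrow> \<rho> y = \<rho> x + 1"
  using rank_function by (simp add: rank_function_def)

lemma cover_below:
  assumes "(x, y) \<in> r" "x \<noteq> y"
  obtains z where "(x, z) \<in> r" "covers r z y"
proof -
  obtain z where z: "(x, z) \<in> r \<and> (z, y) \<in> r \<and> z \<noteq> y"
    and max: "\<And>k. (x, k) \<in> r \<and> (k, y) \<in> r \<and> k \<noteq> y \<Longrightarrow> \<rho> k \<le> \<rho> z"
    using ex_max_rank[of "{z. (x, z) \<in> r \<and> (z, y) \<in> r \<and> z \<noteq> y}" \<rho>]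
      finite_up[of x] assms le_refl[OF assms(1)] by auto
  have "covers r z y"
    unfolding covers_def
  proof (intro conjI allI impI)
    fix w assume w: "(z, w) \<in> r \<and> (w, y) \<in> r"
    show "w = z \<or> w = y"
      using max[of w] rank_less[of z w] le_trans[of x z w] w z by fastforce
  qed (use z in auto)
  with z show ?thesis using that by blast
qed

lemma rank_unique:
  assumes "rank_function r \<rho>'" "x \<in> Field r"
  shows "\<rho>' x = \<rho> x"
  using assms(2)
proof (induction "\<rho> x" arbitrary: x rule: less_induct)
  case less
  show ?case
  proof (cases "\<forall>y. (y, x) \<in> r \<longrightarrow> y = x")
    case True
    then show ?thesis
      using less.prems assms(1) rank_function by (simp add: rank_function_def)
  next
    case False
    then obtain z where z: "covers r z x"
      using cover_below by blast
    moreover have "z \<in> Field r" using z by (auto simp: covers_def FieldI1)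
    moreover have "\<rho>' x = \<rho>' z + 1"
      using z assms(1) by (simp add: rank_function_def)
    ultimately show ?thesis
      using less.hyps[of z] rank_covers[OF z] by simp
  qed
qed

lemma rk_eq: "x \<in> Field r \<Longrightarrow> rk r x = \<rho> x"
  using rank_unique graded_ranked_poset.rank_function[OF graded_poset_ranked[OF graded]] by blast

text \<open>This permits computing an ab-index with whichever rank function is at hand, such as the
  shifted ranks of an interval or ranks carried along a renaming.\<close>

lemma psi_rk:
  assumes "(s, t) \<in> r"
  shows "psi r (rk r) s t = psi r \<rho> s t"
proof -
  interpret rk: graded_ranked_poset r "rk r" by (rule graded_poset_ranked[OF graded])
  have "psi r (rk r) (id s) (id t) = psi r \<rho> s t"
    by (rule psi_embedding[where S = "Field r"])
      (use assms rk.ranked_poset_axioms in \<open>auto simp: rk_eq FieldI1 FieldI2\<close>)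
  then show ?thesis by simp
qed

lemma rank_interpolation:
  assumes "(x, y) \<in> r" "\<rho> x \<le> j" "j \<le> \<rho> y"
  obtains z where "(x, z) \<in> r" "(z, y) \<in> r" "\<rho> z = j"
  using assms
proof (induction "\<rho> y" arbitrary: y thesis rule: less_induct)
  case less
  show ?case
  proof (cases "\<rho> y = j")
    case True
    then show ?thesis using less.prems(1)[of y] less.prems(2) le_refl[OF less.prems(2)] by simp
  next
    case False
    with less.prems have "x \<noteq> y" by auto
    with less.prems obtain z where z: "(x, z) \<in> r" "covers r z y"
      using cover_below by blast
    then have zy: "(z, y) \<in> r" "\<rho> y = \<rho> z + 1"
      using rank_covers by (auto simp: covers_def)
    have "\<rho> z < \<rho> y" "j \<le> \<rho> z" using zy False less.prems by auto
    from less.hyps[OF this(1) _ z(1) less.prems(3) this(2)] obtain w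
      where "(x, w) \<in> r" "(w, z) \<in> r" "\<rho> w = j" by blast
    then show ?thesis using less.prems(1) zy le_trans by blast
  qed
qed

end


section \<open>Flag numbers and words in b and a - b\<close>

definition chain_monomial :: "nat \<Rightarrow> nat set \<Rightarrow> ab nc_poly" where
  "chain_monomial m T = prod_list (map (\<lambda>i. if i \<in> T then bv else av - bv) [1..<m + 1])"

lemma chain_monomial_empty: "chain_monomial m {} = (av - bv) ^ m"
  by (induction m) (simp_all add: chain_monomial_def power_Suc2 del: power_Suc)

text \<open>Splitting at the largest rank of a chain mirrors the right recursion of
  \<open>psi\<close>.\<close>

lemma chain_monomial_insert:
  assumes "T \<subseteq> {1..<j}" "1 \<le> j" "j \<le> m"
  shows "chain_monomial m (insert j T) = chain_monomial (j - 1) T * bv * (av - bv) ^ (m - j)"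
proof -
  have *: "prod_list (map (\<lambda>i. if i = j \<or> i \<in> T then bv else av - bv) [Suc j..<k]) =
      (av - bv) ^ (k - Suc j)" for k
  proof (induction k)
    case (Suc k)
    show ?case
    proof (cases "j < k")
      case True
      then have "Suc k - Suc j = Suc (k - Suc j)" "k \<noteq> j" "k \<notin> T"
        using assms by auto
      with True Suc show ?thesis by (simp add: power_Suc2 del: power_Suc diff_Suc_Suc)
    qed simp
  qed simp
  have "[1..<m + 1] = [1..<j] @ j # [Suc j..<m + 1]"
    using assms upt_add_eq_append[of 1 j "m + 1 - j"] upt_conv_Cons[of j "m + 1"] by simp
  then have "chain_monomial m (insert j T) =
      prod_list (map (\<lambda>i. if i \<in> insert j T then bv else av - bv) [1..<j]) * bv * (av - bv) ^ (m - j)"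
    using *[of "m + 1"] by (simp add: chain_monomial_def mult.assoc del: upt_Suc)
  also have "map (\<lambda>i. if i \<in> insert j T then bv else av - bv) [1..<j] =
      map (\<lambda>i. if i \<in> T then bv else av - bv) [1..<j - 1 + 1]"
    using assms by auto
  finally show ?thesis by (simp only: chain_monomial_def)
qed

text \<open>Expanding the product chooses a letter at every rank outside \<open>T\<close>, and each
  choice of \<open>b\<close> there costs a sign; \<open>S\<close> collects all positions of
  \<open>b\<close>. Intersecting \<open>T\<close> with \<open>{1..m}\<close> lets \<open>T\<close>
  stay fixed in the induction on \<open>m\<close>.\<close>

lemma chain_monomial_expansion:
  "chain_monomial m T = (\<Sum>S\<in>Pow {1..m}. if T \<inter> {1..m} \<subseteq> S
     then Poly_Mapping.single (ab_word m S) ((- 1) ^ card (S - T)) else 0)"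
proof (induction m)
  case 0
  show ?case
    by (simp add: chain_monomial_def ab_word_def flip: zero_nc_word_def)
next
  case (Suc m)
  let ?g = "\<lambda>m S. if T \<inter> {1..m} \<subseteq> S
     then Poly_Mapping.single (ab_word m S) ((- 1) ^ card (S - T)) else (0 :: ab nc_poly)"
  have word: "Poly_Mapping.single (ab_word (Suc m) S) k =
      Poly_Mapping.single (ab_word m S) k * (if Suc m \<in> S then bv else av)" for S and k :: int
    by (simp add: ab_word_def nc_var_def mult_single plus_nc_word_def)
  have word_insert: "ab_word m (insert (Suc m) S) = ab_word m S" for S
    by (simp add: ab_word_def)
  have Pow: "Pow {1..Suc m} = Pow {1..m} \<union> insert (Suc m) ` Pow {1..m}"
    by (simp add: atLeastAtMostSuc_conv Pow_insert)
  have inj: "inj_on (insert (Suc m)) (Pow {1..m})"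
    by (rule inj_onI) (metis Pow_iff atLeastAtMost_iff insert_ident not_less_eq_eq order_refl subsetD)
  have "(\<Sum>S\<in>Pow {1..Suc m}. ?g (Suc m) S) =
      (\<Sum>S\<in>Pow {1..m}. ?g (Suc m) S) + (\<Sum>S\<in>insert (Suc m) ` Pow {1..m}. ?g (Suc m) S)"
    unfolding Pow by (rule sum.union_disjoint) auto
  also have "\<dots> = (\<Sum>S\<in>Pow {1..m}. ?g (Suc m) S + ?g (Suc m) (insert (Suc m) S))"
    unfolding sum.reindex[OF inj] by (simp add: sum.distrib)
  also have "\<dots> = (\<Sum>S\<in>Pow {1..m}. ?g m S * (if Suc m \<in> T then bv else av - bv))"
  proof (rule sum.cong[OF refl])
    fix S assume "S \<in> Pow {1..m}"
    then have S: "finite S" "Suc m \<notin> S" "S \<subseteq> {1..m}" by (auto intro: finite_subset)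
    have *: "T \<inter> {1..Suc m} \<subseteq> insert (Suc m) S \<longleftrightarrow> T \<inter> {1..m} \<subseteq> S"
      using S by (auto simp: atLeastAtMostSuc_conv)
    show "?g (Suc m) S + ?g (Suc m) (insert (Suc m) S) = ?g m S * (if Suc m \<in> T then bv else av - bv)"
    proof (cases "Suc m \<in> T")
      case True
      then have "\<not> T \<inter> {1..Suc m} \<subseteq> S" using S by auto
      then show ?thesis
        unfolding * using True S by (simp add: word word_insert insert_Diff_if)
    next
      case False
      then have **: "T \<inter> {1..Suc m} \<subseteq> S \<longleftrightarrow> T \<inter> {1..m} \<subseteq> S"
        by (auto simp: atLeastAtMostSuc_conv)
      show ?thesis
        unfolding * ** using False S
        by (simp add: word word_insert insert_Diff_if single_uminus right_diff_distrib)
    qed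
  qed
  also have "\<dots> = chain_monomial (Suc m) T"
  proof -
    have "chain_monomial (Suc m) T = chain_monomial m T * (if Suc m \<in> T then bv else av - bv)"
      by (simp add: chain_monomial_def)
    then show ?thesis by (simp only: Suc.IH sum_distrib_right)
  qed
  finally show ?case by simp
qed

lemma sum_flag_beta:
  "(\<Sum>S\<in>Pow {1..m}. Poly_Mapping.single (ab_word m S) (flag_beta r S)) =
   (\<Sum>T\<in>Pow {1..m}. of_nat (flag_alpha r T) * chain_monomial m T)"
proof -
  have single: "Poly_Mapping.single w (k * int n) = of_nat n * Poly_Mapping.single w k"
    for w :: "ab nc_word" and k n
    using mult_single[of 0 "int n" w k] by (simp add: mult.commute)
  have "(\<Sum>S\<in>Pow {1..m}. Poly_Mapping.single (ab_word m S) (flag_beta r S)) =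
      (\<Sum>S\<in>Pow {1..m}. \<Sum>T | T \<in> Pow {1..m} \<and> T \<subseteq> S.
        Poly_Mapping.single (ab_word m S) ((- 1) ^ card (S - T) * int (flag_alpha r T)))"
  proof (rule sum.cong[OF refl])
    fix S assume "S \<in> Pow {1..m}"
    then have "{T. T \<in> Pow {1..m} \<and> T \<subseteq> S} = Pow S" "finite S"
      by (auto intro: finite_subset)
    then show "Poly_Mapping.single (ab_word m S) (flag_beta r S) =
        (\<Sum>T | T \<in> Pow {1..m} \<and> T \<subseteq> S.
        Poly_Mapping.single (ab_word m S) ((- 1) ^ card (S - T) * int (flag_alpha r T)))"
      unfolding flag_beta_def
      by (intro poly_mapping_eqI) (simp add: lookup_sum lookup_single when_def)
  qed
  also have "\<dots> = (\<Sum>T\<in>Pow {1..m}. \<Sum>S | S \<in> Pow {1..m} \<and> T \<subseteq> S.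
        Poly_Mapping.single (ab_word m S) ((- 1) ^ card (S - T) * int (flag_alpha r T)))"
    by (rule sum.swap_restrict) auto
  also have "\<dots> = (\<Sum>T\<in>Pow {1..m}. of_nat (flag_alpha r T) * chain_monomial m T)"
  proof (rule sum.cong[OF refl])
    fix T assume "T \<in> Pow {1..m}"
    then have T: "T \<inter> {1..m} = T" by auto
    show "(\<Sum>S | S \<in> Pow {1..m} \<and> T \<subseteq> S.
        Poly_Mapping.single (ab_word m S) ((- 1) ^ card (S - T) * int (flag_alpha r T))) =
        of_nat (flag_alpha r T) * chain_monomial m T"
      unfolding single chain_monomial_expansion T sum.inter_filter[OF finite_Pow_iff[THEN iffD2, OF finite_atLeastAtMost]]
        sum_distrib_left
      by (rule sum.cong) auto
  qed
  finally show ?thesis .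
qed


section \<open>Chains and rank-selected subposets\<close>

context graded_ranked_poset
begin

abbreviation open_chains :: "'a \<Rightarrow> 'a \<Rightarrow> 'a set set" where
  "open_chains s t \<equiv> {K \<in> Chains r. K \<subseteq> open_interval r s t}"

lemma chain_comparable:
  "K \<in> Chains r \<Longrightarrow> x \<in> K \<Longrightarrow> y \<in> K \<Longrightarrow> \<rho> x \<le> \<rho> y \<Longrightarrow> (x, y) \<in> r"
  using rank_less[of y x] by (fastforce simp: Chains_def)

lemma open_chains_bij:
  "bij_betw (\<lambda>(z, K). insert z K) (SIGMA z:open_interval r s t. open_chains s z)
     (open_chains s t - {{}})"
proof (rule bij_betw_imageI)
  let ?\<C> = "SIGMA z:open_interval r s t. open_chains s z"
  show "inj_on (\<lambda>(z, K). insert z K) ?\<C>"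
  proof (rule inj_onI, clarify)
    fix z K z' K'
    assume K: "K \<subseteq> open_interval r s z" "K' \<subseteq> open_interval r s z'"
      and eq: "insert z K = insert z' K'"
    have "z = z' \<or> z \<in> K'" "z = z' \<or> z' \<in> K" using eq by auto
    then have "z = z'"
      using K antisym[of z z'] by (auto simp: open_interval_def)
    moreover have "z \<notin> K" "z' \<notin> K'"
      using K by (auto simp: open_interval_def)
    ultimately show "z = z' \<and> K = K'" using eq by (auto simp: insert_ident)
  qed
  have "insert z K \<in> open_chains s t - {{}}"
    if "z \<in> open_interval r s t" "K \<in> open_chains s z" for z K
  proof -
    have "insert z K \<in> Chains r"
      using that le_refl[of z t] by (auto simp: Chains_def open_interval_def)
    moreover have "K \<subseteq> open_interval r s t"
      using that le_trans[of _ z t] antisym[of z t] by (auto simp: open_interval_def)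
    ultimately show ?thesis using that by auto
  qed
  moreover have "K \<in> (\<lambda>(z, K). insert z K) ` ?\<C>" if K: "K \<in> open_chains s t" "K \<noteq> {}" for K
  proof -
    have "finite K" using K finite_open_interval finite_subset by blast
    then obtain z where z: "z \<in> K" "\<And>k. k \<in> K \<Longrightarrow> \<rho> k \<le> \<rho> z"
      using ex_max_rank[of K \<rho>] K by auto
    have "(k, z) \<in> r" if "k \<in> K" for k
      using chain_comparable[of K k z] K z that by auto
    then have "K - {z} \<in> open_chains s z"
      using K by (auto simp: Chains_def open_interval_def)
    then show ?thesis
      using z K by (intro image_eqI[of _ _ "(z, K - {z})"]) auto
  qed
  ultimately show "(\<lambda>(z, K). insert z K) ` ?\<C> = open_chains s t - {{}}" by auto
qed

lemma psi_chains:
  assumes "\<rho> s = 0" "(s, t) \<in> r" "s \<noteq> t"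
  shows "psi r \<rho> s t = (\<Sum>K\<in>open_chains s t. chain_monomial (\<rho> t - 1) (\<rho> ` K))"
  using assms(2,3)
proof (induction "\<rho> t" arbitrary: t rule: less_induct)
  case less
  let ?m = "\<rho> t - 1"
  have fin: "finite (open_chains s t)" for t
    using finite_open_interval[of s t] by (auto intro: finite_subset[of _ "Pow (open_interval r s t)"])
  have empty: "{} \<in> open_chains s t" by (simp add: Chains_def)
  have "(\<Sum>K\<in>open_chains s t. chain_monomial ?m (\<rho> ` K)) =
      chain_monomial ?m {} + (\<Sum>K\<in>open_chains s t - {{}}. chain_monomial ?m (\<rho> ` K))"
    using sum.remove[OF fin empty, of "\<lambda>K. chain_monomial ?m (\<rho> ` K)"] by simp
  also have "(\<Sum>K\<in>open_chains s t - {{}}. chain_monomial ?m (\<rho> ` K)) =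
      (\<Sum>(z, K)\<in>(SIGMA z:open_interval r s t. open_chains s z). chain_monomial ?m (\<rho> ` insert z K))"
    unfolding sum.reindex_bij_betw[OF open_chains_bij, symmetric] by (simp add: case_prod_unfold)
  also have "\<dots> = (\<Sum>z\<in>open_interval r s t. \<Sum>K\<in>open_chains s z. chain_monomial ?m (\<rho> ` insert z K))"
    by (rule sum.Sigma[symmetric]) (use fin finite_open_interval in auto)
  also have "\<dots> = (\<Sum>z\<in>open_interval r s t. psi r \<rho> s z * bv * (av - bv) ^ (\<rho> t - \<rho> z - 1))"
  proof (rule sum.cong[OF refl])
    fix z assume "z \<in> open_interval r s t"
    then have z: "(s, z) \<in> r" "s \<noteq> z" "\<rho> z < \<rho> t" "0 < \<rho> z"
      using rank_less[of z t] rank_less[of s z] by (auto simp: open_interval_def)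
    have "chain_monomial ?m (\<rho> ` insert z K) =
        chain_monomial (\<rho> z - 1) (\<rho> ` K) * bv * (av - bv) ^ (\<rho> t - \<rho> z - 1)"
      if "K \<in> open_chains s z" for K
    proof -
      have "\<rho> ` K \<subseteq> {1..<\<rho> z}"
        using that rank_less[of s] rank_less[of _ z] by (fastforce simp: open_interval_def)
      then show ?thesis
        using chain_monomial_insert[of "\<rho> ` K" "\<rho> z" ?m] z by (simp add: diff_right_commute)
    qed
    then show "(\<Sum>K\<in>open_chains s z. chain_monomial ?m (\<rho> ` insert z K)) =
        psi r \<rho> s z * bv * (av - bv) ^ (\<rho> t - \<rho> z - 1)"
      using less.hyps[OF z(3,1,2)] by (simp add: sum_distrib_right)
  qed
  finally show ?case
    unfolding psi_right[of s t] chain_monomial_empty assms(1) by simp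
qed

text \<open>Comparable elements of equal rank coincide, so a chain meeting every rank of
  \<open>T\<close> cannot grow. Conversely, if a chain misses a rank of \<open>T\<close>, gradedness
  supplies an element of that rank between the neighbouring elements of the chain.\<close>

lemma maximal_chains_rank_selected:
  assumes "\<rho> s = 0" "is_bot r s" "is_top r t" "T \<subseteq> {1..<\<rho> t}"
  shows "maximal_chains (Restr r {x. \<rho> x \<in> T}) = {K \<in> open_chains s t. \<rho> ` K = T}"
proof -
  let ?R = "Restr r {x. \<rho> x \<in> T}"
  have Chains: "K \<in> Chains ?R \<longleftrightarrow> K \<in> Chains r \<and> \<rho> ` K \<subseteq> T" for K
    by (auto simp: Chains_def)
  have Field: "K \<subseteq> Field r" if "K \<in> Chains r" for K
  proof
    fix x assume "x \<in> K"
    then have "(x, x) \<in> r" using that by (auto simp: Chains_def)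
    then show "x \<in> Field r" by (rule FieldI1)
  qed
  show ?thesis
  proof (intro equalityI subsetI)
    fix K assume "K \<in> {K \<in> open_chains s t. \<rho> ` K = T}"
    then have K: "K \<in> Chains r" "\<rho> ` K = T" by auto
    have "L = K" if L: "L \<in> Chains r" "\<rho> ` L \<subseteq> T" "K \<subseteq> L" for L
    proof (rule equalityI[OF subsetI L(3)])
      fix x assume x: "x \<in> L"
      then have "\<rho> x \<in> \<rho> ` K" using L(2) K(2) by auto
      then obtain y where y: "y \<in> K" "\<rho> x = \<rho> y" by auto
      then have "(x, y) \<in> r" "(y, x) \<in> r"
        using chain_comparable[OF L(1), of x y] chain_comparable[OF L(1), of y x] x L(3) by auto
      then have "x = y" by (rule antisym)
      then show "x \<in> K" using y by simp
    qed
    then show "K \<in> maximal_chains ?R"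
      using K by (auto simp: maximal_chains_def Chains)
  next
    fix K assume "K \<in> maximal_chains ?R"
    then have K: "K \<in> Chains r" "\<rho> ` K \<subseteq> T"
      and max: "\<And>L. L \<in> Chains r \<Longrightarrow> \<rho> ` L \<subseteq> T \<Longrightarrow> K \<subseteq> L \<Longrightarrow> L = K"
      by (auto simp: maximal_chains_def Chains)
    have finK: "finite K" using Field[OF K(1)] finite_Field finite_subset by blast
    have st: "(s, x) \<in> r" "(x, t) \<in> r" if "x \<in> K" for x
      using that Field[OF K(1)] assms(2,3) by (auto simp: is_bot_def is_top_def)
    have "x \<noteq> s" "x \<noteq> t" if "x \<in> K" for x
      using that K(2) assms(1,4) by force+
    then have "K \<subseteq> open_interval r s t" using st by (auto simp: open_interval_def)
    moreover have "T \<subseteq> \<rho> ` K"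
    proof
      fix j assume j: "j \<in> T"
      show "j \<in> \<rho> ` K"
      proof (rule ccontr)
        assume notin: "j \<notin> \<rho> ` K"
        have j': "0 < j" "j < \<rho> t" using j assms(4) by auto
        \<comment> \<open>\<open>y\<close> and \<open>z\<close> are the neighbours of the missing
          rank \<open>j\<close> in the chain, with \<open>s\<close> and \<open>t\<close> as
          sentinels. The least rank above \<open>j\<close> is found by maximising the distance to
          \<open>t\<close>.\<close>
        obtain y where y: "y \<in> insert s {x \<in> K. \<rho> x < j}"
          and y_max: "\<And>k. k \<in> insert s {x \<in> K. \<rho> x < j} \<Longrightarrow> \<rho> k \<le> \<rho> y"
          using ex_max_rank[of "insert s {x \<in> K. \<rho> x < j}" \<rho>] finK by auto
        obtain z where z: "z \<in> insert t {x \<in> K. j < \<rho> x}"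
          and z_min: "\<And>k. k \<in> insert t {x \<in> K. j < \<rho> x} \<Longrightarrow> \<rho> t - \<rho> k \<le> \<rho> t - \<rho> z"
          using ex_max_rank[of "insert t {x \<in> K. j < \<rho> x}" "\<lambda>x. \<rho> t - \<rho> x"] finK by auto
        have rk: "\<rho> y < j" "j < \<rho> z" using y z j' assms(1) by auto
        have stf: "(s, t) \<in> r" using assms(2,3) by (auto simp: is_bot_def is_top_def)
        have "(y, z) \<in> r"
          using y z st stf chain_comparable[OF K(1), of y z] rk by auto
        then obtain x where x: "(y, x) \<in> r" "(x, z) \<in> r" "\<rho> x = j"
          using rank_interpolation[of y z j] rk by auto
        have "(k, x) \<in> r \<or> (x, k) \<in> r" if k: "k \<in> K" for k
        proof (cases "\<rho> k < j")
          case True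
          then have "\<rho> k \<le> \<rho> y" using y_max k by auto
          then have "(k, y) \<in> r"
            using y k chain_comparable[OF K(1), of k y] assms(1) st[OF k] rank_less[of s k] by force
          then show ?thesis using x le_trans by blast
        next
          case False
          then have kj: "j < \<rho> k" using notin k by (metis image_eqI linorder_neqE_nat)
          have "\<rho> z \<le> \<rho> k"
            using z_min[of k] k kj rank_le[OF st(2)[OF k]] z rank_le[OF st(2), of z] by auto
          then have "(z, k) \<in> r"
            using z k chain_comparable[OF K(1), of z k] st[OF k] rank_less[of k t] by force
          then show ?thesis using x le_trans by blast
        qed
        then have "insert x K \<in> Chains r"
          using K(1) le_refl[OF x(1)] by (auto simp: Chains_def)
        then have "insert x K = K"
          using max[of "insert x K"] K(2) j x(3) by auto
        then show False using notin x(3) by blast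
      qed
    qed
    ultimately show "K \<in> {K \<in> open_chains s t. \<rho> ` K = T}"
      using K by auto
  qed
qed

end

lemma ab_index_psi:
  assumes "graded_poset r" "is_bot r s" "is_top r t" "s \<noteq> t"
  shows "ab_index r = psi r (rk r) s t"
proof -
  interpret graded_ranked_poset r "rk r" by (rule graded_poset_ranked[OF assms(1)])
  let ?m = "rk r t - 1"
  have s: "rk r s = 0"
    using assms(2) rank_function antisym by (fastforce simp: rank_function_def is_bot_def FieldI1)
  have st: "(s, t) \<in> r" using assms by (auto simp: is_bot_def is_top_def)
  have t: "0 < rk r t" using rank_less[OF st assms(4)] by simp
  have "poset_rank r = rk r t"
    unfolding poset_rank_def using assms(3) finite_Field rank_le
    by (intro Max_eqI) (auto simp: is_top_def)
  then have "ab_index r = (\<Sum>T\<in>Pow {1..?m}. of_nat (flag_alpha r T) * chain_monomial ?m T)"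
    by (simp only: ab_index_def Let_def sum_flag_beta)
  also have "\<dots> = (\<Sum>T\<in>Pow {1..?m}. \<Sum>K | K \<in> open_chains s t \<and> rk r ` K = T.
      chain_monomial ?m (rk r ` K))"
  proof (rule sum.cong[OF refl])
    fix T assume "T \<in> Pow {1..?m}"
    then have "T \<subseteq> {1..<rk r t}" using t by (auto simp: subset_iff)
    from maximal_chains_rank_selected[OF s assms(2,3) this]
    have "flag_alpha r T = card {K. K \<in> open_chains s t \<and> rk r ` K = T}"
      by (simp add: flag_alpha_def)
    then show "of_nat (flag_alpha r T) * chain_monomial ?m T =
        (\<Sum>K | K \<in> open_chains s t \<and> rk r ` K = T. chain_monomial ?m (rk r ` K))"
      by simp
  qed
  also have "\<dots> = (\<Sum>K\<in>open_chains s t. chain_monomial ?m (rk r ` K))"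
  proof (rule sum.group)
    show "finite (open_chains s t)"
      using finite_open_interval[of s t] by (auto intro: finite_subset[of _ "Pow (open_interval r s t)"])
    show "(`) (rk r) ` open_chains s t \<subseteq> Pow {1..?m}"
      using rank_less[of s] rank_less[of _ t] by (fastforce simp: open_interval_def)
  qed simp
  also have "\<dots> = psi r (rk r) s t"
    using psi_chains[OF s st assms(4)] by simp
  finally show ?thesis .
qed

text \<open>The chain expansion requires distinct endpoints; this covers the one-point case of the
  decomposition.\<close>

lemma ab_index_singleton:
  fixes s :: 'a
  shows "ab_index {(s, s)} = 1"
proof -
  have "covers {(s, s)} x y \<longleftrightarrow> False" for x y
    by (auto simp: covers_def)
  then have "rank_function {(s, s)} (\<lambda>_. 0)"
    by (simp add: rank_function_def)
  then have "graded_ranked_poset {(s, s)} (\<lambda>_. 0)"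
    by unfold_locales (auto simp: order_on_defs refl_on_def trans_def antisym_def)
  from graded_ranked_poset.rk_eq[OF this] have "poset_rank {(s, s)} = 0"
    by (simp add: poset_rank_def Field_def)
  moreover have "flag_alpha {(s, s)} {} = 1"
  proof -
    have "maximal_chains ({} :: 'a rel) = {{}}"
      by (auto simp: maximal_chains_def Chains_def)
    then show ?thesis by (simp add: flag_alpha_def)
  qed
  ultimately show ?thesis
    by (simp add: ab_index_def flag_beta_def ab_word_def flip: zero_nc_word_def)
qed

section \<open>Intervals, images and Eulerian posets\<close>

lemma sum_minus_one_power_eq_card_diff:
  "finite X \<Longrightarrow> (\<Sum>x\<in>X. (- 1) ^ f x) = int (card {x \<in> X. even (f x)}) - int (card {x \<in> X. odd (f x)})"
proof (induction X rule: finite_induct)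
  case (insert x X)
  have "{y \<in> insert x X. P y} = (if P x then insert x {y \<in> X. P y} else {y \<in> X. P y})" for P
    by auto
  with insert show ?case by auto
qed simp

lemma ab_index_eq_psi:
  assumes "graded_ranked_poset r \<rho>" "is_bot r s" "is_top r t" "s \<noteq> t"
  shows "ab_index r = psi r \<rho> s t"
proof -
  interpret graded_ranked_poset r \<rho> by fact
  have "(s, t) \<in> r" using assms(2,3) by (auto simp: is_bot_def is_top_def)
  then show ?thesis
    using ab_index_psi[OF graded assms(2-4)] psi_rk by simp
qed

context graded_ranked_poset
begin

lemma rank_bot:
  assumes "is_bot r s"
  shows "\<rho> s = 0"
proof -
  have "y = s" if "(y, s) \<in> r" for y
    using assms FieldI1[OF that] antisym[OF that] by (simp add: is_bot_def)
  then show ?thesis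
    using assms rank_function by (simp add: rank_function_def is_bot_def)
qed

lemma poset_rank_eq_Max: "poset_rank r = Max (\<rho> ` Field r)"
  unfolding poset_rank_def using rk_eq by (simp cong: image_cong)

lemma interval_iff: "(x, y) \<in> interval r s t \<longleftrightarrow> (s, x) \<in> r \<and> (x, y) \<in> r \<and> (y, t) \<in> r"
  unfolding interval_def using le_trans[of s x y] le_trans[of x y t] by auto

lemma Field_interval: "Field (interval r s t) = {x. (s, x) \<in> r \<and> (x, t) \<in> r}"
proof -
  have "(x, x) \<in> interval r s t" if "(s, x) \<in> r" "(x, t) \<in> r" for x
    using that le_refl[OF that(1)] by (simp add: interval_iff)
  then show ?thesis
    by (auto simp: Field_def interval_def)
qed

lemma interval_bot_top:
  assumes "(s, t) \<in> r"
  shows "is_bot (interval r s t) s" "is_top (interval r s t) t"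
  using assms le_refl[OF assms] unfolding is_bot_def is_top_def Field_interval by (auto simp: interval_iff)

lemma graded_down_set:
  assumes "\<And>x y. x \<in> S \<Longrightarrow> (y, x) \<in> r \<Longrightarrow> y \<in> S"
  shows "graded_ranked_poset (Restr r S) \<rho>"
proof
  show "finite (Restr r S)" using finite_rel by simp
  show "Partial_order (Restr r S)"
    using partial_order by (rule Partial_order_Restr)
  have "y \<in> S" if "x \<in> Field (Restr r S)" "(y, x) \<in> r" for x y
    using that assms by (auto simp: Field_def)
  moreover have "covers r x y" if "covers (Restr r S) x y" for x y
    using that assms by (auto simp: covers_def)
  moreover have "Field (Restr r S) \<subseteq> Field r \<inter> S" by (auto simp: Field_def)
  ultimately show "rank_function (Restr r S) \<rho>"
    using rank_function unfolding rank_function_def by blast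
qed

lemma graded_interval:
  assumes "(s, t) \<in> r"
  shows "graded_ranked_poset (interval r s t) (\<lambda>x. \<rho> x - \<rho> s)"
proof
  show "finite (interval r s t)" using finite_rel by (simp add: interval_def)
  show "Partial_order (interval r s t)"
    unfolding interval_def using partial_order by (rule Partial_order_Restr)
  have "\<rho> x - \<rho> s = 0" if "x \<in> Field (interval r s t)" "\<And>y. (y, x) \<in> interval r s t \<Longrightarrow> y = x" for x
    using that(1) that(2)[of s] le_refl[of s x] by (auto simp: Field_interval interval_iff)
  moreover have "\<rho> y - \<rho> s = \<rho> x - \<rho> s + 1" if "covers (interval r s t) x y" for x y
  proof -
    have "covers r x y"
      using that le_trans[of s x] le_trans[of _ y t] by (auto simp: covers_def interval_iff)
    moreover have "(s, x) \<in> r" using that by (simp add: covers_def interval_iff)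
    ultimately show ?thesis using rank_covers[of x y] rank_le[of s x] by simp
  qed
  ultimately show "rank_function (interval r s t) (\<lambda>x. \<rho> x - \<rho> s)"
    unfolding rank_function_def by auto
qed

lemma ab_index_interval:
  assumes "(s, t) \<in> r" "s \<noteq> t"
  shows "ab_index (interval r s t) = psi r \<rho> s t"
proof -
  interpret I: graded_ranked_poset "interval r s t" "\<lambda>x. \<rho> x - \<rho> s"
    by (rule graded_interval) fact
  have refl: "(s, s) \<in> r" "(t, t) \<in> r" using le_refl[OF assms(1)] by auto
  have "psi r \<rho> (id s) (id t) = psi (interval r s t) (\<lambda>x. \<rho> x - \<rho> s) s t"
  proof (rule I.psi_embedding[where S = "{x. (s, x) \<in> r \<and> (x, t) \<in> r}"])
    fix y z assume "y \<in> {x. (s, x) \<in> r \<and> (x, t) \<in> r}" "(id s, z) \<in> r" "(z, id y) \<in> r"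
    then show "z \<in> id ` {x. (s, x) \<in> r \<and> (x, t) \<in> r}"
      using le_trans[of z y t] by simp
  next
    fix x assume "x \<in> {x. (s, x) \<in> r \<and> (x, t) \<in> r}"
    then show "\<rho> (id x) + (\<rho> s - \<rho> s) = \<rho> x - \<rho> s + \<rho> (id s)"
      using rank_le[of s x] by simp
  qed (use assms refl ranked_poset_axioms in \<open>auto simp: interval_iff\<close>)
  moreover have "ab_index (interval r s t) = psi (interval r s t) (\<lambda>x. \<rho> x - \<rho> s) s t"
    by (rule ab_index_eq_psi[OF graded_interval[OF assms(1)] interval_bot_top[OF assms(1)] assms(2)])
  ultimately show ?thesis by simp
qed

text \<open>Needed for the boundary, which is a renamed copy of an interval of the semisuspension;
  the left inverse \<open>h\<close> carries the ranks over.\<close>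

lemma graded_image:
  assumes "\<And>x. h (f x) = x"
  shows "graded_ranked_poset (map_prod f f ` r) (\<rho> \<circ> h)"
proof
  let ?r = "map_prod f f ` r"
  have iff: "(f x, f y) \<in> ?r \<longleftrightarrow> (x, y) \<in> r" for x y
  proof
    assume "(f x, f y) \<in> ?r"
    then obtain x' y' where *: "f x = f x'" "f y = f y'" "(x', y') \<in> r" by auto
    then have "x = x'" "y = y'" using assms by metis+
    with * show "(x, y) \<in> r" by simp
  qed auto
  have ex: "\<exists>x y. u = f x \<and> v = f y \<and> (x, y) \<in> r" if "(u, v) \<in> ?r" for u v
    using that by auto
  have Field: "Field ?r = f ` Field r"
    by (force simp: Field_def)
  show "finite ?r" using finite_rel by simp
  show "Partial_order ?r"
    unfolding order_on_defs
  proof (intro conjI)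
    show "?r \<subseteq> Field ?r \<times> Field ?r" by (auto simp: Field_def)
    show "refl_on (Field ?r) ?r"
      using partial_order unfolding Field by (auto simp: refl_on_def iff order_on_defs)
    show "trans ?r"
    proof (rule transI)
      fix u v w assume uv: "(u, v) \<in> ?r" and vw: "(v, w) \<in> ?r"
      obtain x y where x: "u = f x" "v = f y" "(x, y) \<in> r" using ex[OF uv] by blast
      obtain y' z where z: "v = f y'" "w = f z" "(y', z) \<in> r" using ex[OF vw] by blast
      have "y' = y" using assms x z by metis
      then show "(u, w) \<in> ?r" using le_trans[of x y z] x z by (simp only: iff)
    qed
    show "antisym ?r"
    proof (rule antisymI)
      fix u v assume uv: "(u, v) \<in> ?r" and vu: "(v, u) \<in> ?r"
      obtain x y where x: "u = f x" "v = f y" "(x, y) \<in> r" using ex[OF uv] by blast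
      then have "(y, x) \<in> r" using vu by (simp only: iff)
      then show "u = v" using antisym[of x y] x by simp
    qed
  qed
  show "rank_function ?r (\<rho> \<circ> h)"
    unfolding rank_function_def
  proof (intro conjI ballI impI allI)
    fix u assume "u \<in> Field ?r" and min: "\<forall>v. (v, u) \<in> ?r \<longrightarrow> v = u"
    then obtain x where x: "u = f x" "x \<in> Field r" by (auto simp: Field)
    have "y = x" if "(y, x) \<in> r" for y
    proof -
      have "f y = f x" using min x(1) that iff[of y x] by simp
      then show ?thesis using assms by metis
    qed
    then show "(\<rho> \<circ> h) u = 0"
      using rank_function x assms by (simp add: rank_function_def)
  next
    fix u v assume c: "covers ?r u v"
    then have "(u, v) \<in> ?r" by (simp only: covers_def)
    then obtain x y where xy: "u = f x" "v = f y" "(x, y) \<in> r"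
      using ex by blast
    have "covers r x y"
      unfolding covers_def
    proof (intro conjI allI impI)
      show "x \<noteq> y" using c xy by (auto simp: covers_def)
      fix z assume "(x, z) \<in> r \<and> (z, y) \<in> r"
      then have "f z = f x \<or> f z = f y"
        using c by (simp only: covers_def xy iff)
      then show "z = x \<or> z = y" using assms by metis
    qed (rule xy)
    then show "(\<rho> \<circ> h) v = (\<rho> \<circ> h) u + 1"
      using rank_covers[of x y] xy assms by simp
  qed
qed

end

lemma eulerian_ranked:
  assumes "eulerian r"
  shows "graded_ranked_poset r (rk r)" "eulerian_ranked_poset r (rk r)"
proof -
  show g: "graded_ranked_poset r (rk r)"
    using assms by (auto simp: eulerian_def intro: graded_poset_ranked)
  then interpret graded_ranked_poset r "rk r" .
  show "eulerian_ranked_poset r (rk r)"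
  proof
    fix s t assume "(s, t) \<in> r" "s \<noteq> t"
    then have "card {x \<in> Field (interval r s t). even (rk r x)} =
        card {x \<in> Field (interval r s t). odd (rk r x)}"
      using assms by (simp add: eulerian_def)
    then show "(\<Sum>z | (s, z) \<in> r \<and> (z, t) \<in> r. (- 1) ^ rk r z) = (0 :: int)"
      by (subst sum_minus_one_power_eq_card_diff) (use finite_up in \<open>simp_all add: Field_interval\<close>)
  qed
qed

lemma nc_subst_cd_index_interval:
  assumes "eulerian r" "(s, t) \<in> r" "s \<noteq> t"
  shows "nc_subst cd_to_ab (cd_index (interval r s t)) = psi r (rk r) s t"
proof -
  interpret graded_ranked_poset r "rk r" by (rule eulerian_ranked[OF assms(1)])
  interpret eulerian_ranked_poset r "rk r" by (rule eulerian_ranked[OF assms(1)])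
  show ?thesis
    using nc_subst_cd_index[of "interval r s t"] is_cd_poly_psi[OF assms(2,3)]
      ab_index_interval[OF assms(2,3)] by simp
qed

lemma nc_subst_cd_index_eulerian:
  assumes "eulerian r" "is_bot r s" "is_top r t" "s \<noteq> t"
  shows "nc_subst cd_to_ab (cd_index r) = psi r (rk r) s t"
proof -
  interpret eulerian_ranked_poset r "rk r" by (rule eulerian_ranked[OF assms(1)])
  have "(s, t) \<in> r" using assms(2,3) by (auto simp: is_bot_def is_top_def)
  then show ?thesis
    using nc_subst_cd_index[of r] is_cd_poly_psi[OF _ assms(4)]
      ab_index_eq_psi[OF eulerian_ranked(1)[OF assms(1)] assms(2-4)] by simp
qed

lemma cd_index_singleton: "cd_index {(s, s)} = 1"
proof -
  have "nc_subst cd_to_ab (cd_index {(s, s)}) = nc_subst cd_to_ab 1"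
    using nc_subst_cd_index[of "{(s, s)}"] by (simp add: ab_index_singleton is_cd_poly_simps)
  then show ?thesis by (rule injD[OF inj_nc_subst_cd])
qed

lemma P1_iff [simp]:
  "(Some x, Some y) \<in> P1 r \<longleftrightarrow> (x, y) \<in> r"
  "(Some x, None) \<in> P1 r \<longleftrightarrow> x \<in> Field r"
  "(None, Some x) \<notin> P1 r"
  "(None, None) \<in> P1 r"
  by (auto simp: P1_def)

lemma Field_P1: "Field (P1 r) = insert None (Some ` Field r)"
proof (rule set_eqI)
  fix u
  show "u \<in> Field (P1 r) \<longleftrightarrow> u \<in> insert None (Some ` Field r)"
  proof (cases u)
    case None
    then show ?thesis using FieldI1[of None None "P1 r"] by simp
  next
    case (Some x)
    have "x \<in> Field r" if x: "Some x \<in> Field (P1 r)"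
    proof -
      obtain v where "(Some x, v) \<in> P1 r \<or> (v, Some x) \<in> P1 r"
        using x unfolding Field_def by blast
      then show ?thesis by (cases v) (auto intro: FieldI1 FieldI2)
    qed
    then show ?thesis
      using Some FieldI1[of "Some x" None "P1 r"] by auto
  qed
qed

section \<open>Semisuspensions\<close>

text \<open>In a semisuspension of \<open>P1 r\<close>, \<open>None\<close> is the extra coatom,
  \<open>Some None\<close> the top, and \<open>SS y\<close> the copy of an element \<open>y\<close>
  of \<open>r\<close>.\<close>

abbreviation SS :: "'a \<Rightarrow> 'a option option" where "SS y \<equiv> Some (Some y)"

locale semisuspended = graded_ranked_poset +
  fixes s :: 'a and k :: nat and Q :: "'a option option rel"
  assumes bot: "is_bot r s"
    and rank_attained: "\<exists>y\<in>Field r. \<rho> y = k"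
    and rank_bound: "\<And>y. y \<in> Field r \<Longrightarrow> \<rho> y \<le> k"
    and semisuspension: "is_semisuspension (P1 r) Q"
begin

lemma Q_eulerian: "eulerian Q"
  using semisuspension by (simp add: is_semisuspension_def)

sublocale Q: graded_ranked_poset Q "rk Q"
  by (rule eulerian_ranked[OF Q_eulerian])

sublocale Q: eulerian_ranked_poset Q "rk Q"
  by (rule eulerian_ranked[OF Q_eulerian])

lemma s_le: "y \<in> Field r \<Longrightarrow> (s, y) \<in> r" and s_Field: "s \<in> Field r"
  using bot by (auto simp: is_bot_def)

lemma Restr_Q: "Restr Q (Field Q - {None}) = map_prod Some Some ` P1 r"
  using semisuspension by (simp add: is_semisuspension_def)

lemma Q_Some_iff: "(Some u, Some v) \<in> Q \<longleftrightarrow> (u, v) \<in> P1 r"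
proof -
  have "(Some u, Some v) \<in> Q \<longleftrightarrow> (Some u, Some v) \<in> Restr Q (Field Q - {None})"
    by (auto intro: FieldI1 FieldI2)
  then show ?thesis unfolding Restr_Q by auto
qed

lemma Q_SS_iff [simp]:
  "(SS x, SS y) \<in> Q \<longleftrightarrow> (x, y) \<in> r"
  "(SS x, Some None) \<in> Q \<longleftrightarrow> x \<in> Field r"
  "(Some None, SS x) \<notin> Q"
  "(Some None, Some None) \<in> Q"
  by (simp_all add: Q_Some_iff)

lemma covers_top: "covers Q None (Some None)"
  and top: "is_top Q (Some None)"
proof -
  obtain t where t: "is_top Q t" "covers Q None t"
    using semisuspension by (auto simp: is_semisuspension_def coatom_def)
  have "Some None \<in> Field Q" using FieldI1[OF Q_SS_iff(4)] .
  then have "(Some None, t) \<in> Q" using t by (simp add: is_top_def)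
  moreover have "t \<noteq> None" using t by (auto simp: covers_def)
  ultimately have "t = Some None"
    by (cases t; cases "the t") auto
  with t show "covers Q None (Some None)" "is_top Q (Some None)" by auto
qed

lemma Q_None_iff [simp]:
  "(None, None) \<in> Q" "(None, Some None) \<in> Q" "(None, SS x) \<notin> Q" "(Some None, None) \<notin> Q"
proof -
  show 1: "(None, Some None) \<in> Q" using covers_top by (simp add: covers_def)
  show "(None, None) \<in> Q" using Q.le_refl[OF 1] by simp
  show "(Some None, None) \<notin> Q" using Q.antisym[OF 1] by auto
  show "(None, SS x) \<notin> Q"
  proof
    assume *: "(None, SS x) \<in> Q"
    then have "(SS x, Some None) \<in> Q" using top FieldI2[of None "SS x" Q] unfolding is_top_def by blast
    then show False using * covers_top by (auto simp: covers_def)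
  qed
qed

lemma below_SS:
  assumes "(u, SS y) \<in> Q"
  obtains x where "u = SS x" "(x, y) \<in> r"
  using assms by (cases u; cases "the u") auto

lemma bot_Q: "is_bot Q (SS s)"
proof -
  obtain b where b: "is_bot Q b" using Q_eulerian by (auto simp: eulerian_def)
  have "SS s \<in> Field Q" using FieldI1[of "SS s" "Some None" Q] s_Field by simp
  with b have "(b, SS s) \<in> Q" by (simp add: is_bot_def)
  then obtain y where y: "b = SS y" "(y, s) \<in> r" by (rule below_SS)
  then have "y = s" using antisym[OF y(2)] s_le[OF FieldI1[OF y(2)]] by simp
  with b y show ?thesis by simp
qed

lemma rk_SS:
  assumes "y \<in> Field r"
  shows "rk Q (SS y) = \<rho> y"
proof -
  have "rank_function r (\<lambda>y. rk Q (SS y))"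
    unfolding rank_function_def
  proof (intro conjI ballI impI allI)
    fix x assume x: "x \<in> Field r" "\<forall>y. (y, x) \<in> r \<longrightarrow> y = x"
    then have "x = s" using s_le[OF x(1)] by auto
    then show "rk Q (SS x) = 0" using Q.rank_bot[OF bot_Q] by simp
  next
    fix x y assume *: "covers r x y"
    have "covers Q (SS x) (SS y)"
      unfolding covers_def
    proof (intro conjI allI impI)
      fix z assume z: "(SS x, z) \<in> Q \<and> (z, SS y) \<in> Q"
      then obtain w where "z = SS w" using below_SS by blast
      then show "z = SS x \<or> z = SS y" using z * by (simp add: covers_def)
    qed (use * in \<open>simp_all add: covers_def\<close>)
    then show "rk Q (SS y) = rk Q (SS x) + 1" by (rule Q.rank_covers)
  qed
  from rank_unique[OF this assms] show ?thesis .
qed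

text \<open>An element of rank \<open>k\<close> is maximal in \<open>r\<close>. If the top did not
  cover it, only the extra coatom could lie between them; but the resulting three-element chain
  violates the Euler relation.\<close>

lemma rk_top: "rk Q (Some None) = k + 1"
proof -
  obtain y where y: "y \<in> Field r" "\<rho> y = k" using rank_attained by blast
  have above: "w = y" if "(y, w) \<in> r" for w
    using rank_less[OF that] rank_bound[OF FieldI2[OF that]] y(2) by fastforce
  have "covers Q (SS y) (Some None)"
  proof (rule ccontr)
    assume not: "\<not> covers Q (SS y) (Some None)"
    have None: "(SS y, None) \<in> Q"
    proof -
      obtain z where z: "(SS y, z) \<in> Q" "(z, Some None) \<in> Q" "z \<noteq> SS y" "z \<noteq> Some None"
        using not y by (auto simp: covers_def)
      then have "z = None" using above by (cases z; cases "the z") auto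
      with z show ?thesis by simp
    qed
    have between: "z = SS y \<or> z = None \<or> z = Some None" if "(SS y, z) \<in> Q" for z
      using that above by (cases z; cases "the z") auto
    have "covers Q (SS y) None"
      using None between by (fastforce simp: covers_def)
    then have "rk Q None = rk Q (SS y) + 1" "rk Q (Some None) = rk Q (SS y) + 2"
      using Q.rank_covers[OF covers_top] Q.rank_covers by auto
    moreover have "{z. (SS y, z) \<in> Q \<and> (z, Some None) \<in> Q} = {SS y, None, Some None}"
      using None between y le_refl[OF s_le[OF y(1)]] by auto
    ultimately show False
      using Q.alternating_sum[of "SS y" "Some None"] y by simp
  qed
  then show ?thesis using Q.rank_covers rk_SS y by simp
qed

lemma rk_None: "rk Q None = k"
  using Q.rank_covers[OF covers_top] rk_top by simp

lemma k_pos: "0 < k"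
proof -
  have "(SS s, None) \<in> Q" using bot_Q FieldI1[OF Q_None_iff(1)] by (simp add: is_bot_def)
  then have "rk Q (SS s) < rk Q None" by (rule Q.rank_less) simp
  then show ?thesis by (simp add: rk_None)
qed

section \<open>Boundary and interior of a semisuspended poset\<close>

definition bd :: "'a set" where "bd = {y \<in> Field r. (SS y, None) \<in> Q}"

lemma bd_iff: "(SS y, None) \<in> Q \<longleftrightarrow> y \<in> bd"
proof -
  have "y \<in> Field r" if "(SS y, None) \<in> Q"
    using Q.le_trans[OF that Q_None_iff(2)] by simp
  then show ?thesis by (auto simp: bd_def)
qed

lemma bd_down: "y \<in> bd \<Longrightarrow> (x, y) \<in> r \<Longrightarrow> x \<in> bd"
  using Q.le_trans[of "SS x" "SS y" None] by (simp flip: bd_iff)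

lemma bd_Field: "bd \<subseteq> Field r"
  by (auto simp: bd_def)

lemma rank_bd: "y \<in> bd \<Longrightarrow> \<rho> y < k"
  using Q.rank_less[of "SS y" None] rk_SS bd_Field by (auto simp: rk_None bd_iff)

lemma s_bd: "s \<in> bd"
  using bot_Q FieldI1[OF Q_None_iff(1)] by (simp add: is_bot_def flip: bd_iff)

text \<open>The Euler relation between \<open>SS y\<close> and the top of \<open>Q\<close>: the top
  adds \<open>(- 1) ^ (k + 1)\<close>, and the extra coatom, when it lies above \<open>y\<close>,
  cancels this with \<open>(- 1) ^ k\<close>.\<close>

lemma alternating_sum_up:
  assumes "y \<in> Field r"
  shows "(\<Sum>z | (y, z) \<in> r. (- 1) ^ \<rho> z) = (if y \<in> bd then 0 else (- 1) ^ k :: int)"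
proof -
  let ?N = "if y \<in> bd then {None} else ({} :: 'a option option set)"
  have eq: "{z. (SS y, z) \<in> Q \<and> (z, Some None) \<in> Q} = SS ` {z. (y, z) \<in> r} \<union> ({Some None} \<union> ?N)"
  proof (rule set_eqI)
    fix u
    show "u \<in> {z. (SS y, z) \<in> Q \<and> (z, Some None) \<in> Q} \<longleftrightarrow>
        u \<in> SS ` {z. (y, z) \<in> r} \<union> ({Some None} \<union> ?N)"
      using assms by (cases u; cases "the u") (auto simp: bd_iff FieldI2 split: if_splits)
  qed
  have "(0 :: int) = (\<Sum>z | (SS y, z) \<in> Q \<and> (z, Some None) \<in> Q. (- 1) ^ rk Q z)"
    by (rule Q.alternating_sum[symmetric]) (use assms in auto)
  also have "\<dots> = (\<Sum>z\<in>SS ` {z. (y, z) \<in> r}. (- 1) ^ rk Q z) + (\<Sum>z\<in>{Some None} \<union> ?N. (- 1) ^ rk Q z)"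
    unfolding eq by (rule sum.union_disjoint) (use finite_up[of y "\<lambda>_. True"] in auto)
  also have "(\<Sum>z\<in>SS ` {z. (y, z) \<in> r}. (- 1) ^ rk Q z) = (\<Sum>z | (y, z) \<in> r. (- 1) ^ \<rho> z :: int)"
    by (subst sum.reindex) (auto simp: inj_on_def rk_SS FieldI2 intro!: sum.cong)
  finally show ?thesis by (auto simp: rk_top rk_None)
qed

text \<open>The one freedom in \<open>Q\<close> is which elements lie below the extra coatom, and by
  \<open>alternating_sum_up\<close> this can be read off from \<open>r\<close>.\<close>

lemma semisuspension_unique:
  assumes "is_semisuspension (P1 r) Q'"
  shows "Q' = Q"
proof -
  interpret Q': semisuspended r \<rho> s k Q'
    by unfold_locales (use bot rank_attained rank_bound assms in auto)
  have "y \<in> bd \<longleftrightarrow> y \<in> Q'.bd" for y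
  proof (cases "y \<in> Field r")
    case True
    then show ?thesis
      using alternating_sum_up[OF True] Q'.alternating_sum_up[OF True] by (auto split: if_splits)
  next
    case False
    then show ?thesis using bd_Field Q'.bd_Field by auto
  qed
  then have None: "(SS y, None) \<in> Q' \<longleftrightarrow> (SS y, None) \<in> Q" for y
    by (simp add: bd_iff Q'.bd_iff)
  have "(u, v) \<in> Q' \<longleftrightarrow> (u, v) \<in> Q" for u v
    by (cases u; cases "the u"; cases v; cases "the v") (simp_all add: None)
  then show ?thesis by (auto simp: set_eq_iff)
qed

lemma semisuspension_eq: "semisuspension (P1 r) = Q"
  unfolding semisuspension_def using semisuspension semisuspension_unique by (rule the_equality)

lemma not_two_chain: "\<not> two_chain (P1 r)"
proof
  assume "two_chain (P1 r)"
  then obtain x y where "P1 r = {(x, x), (x, y), (y, y)}"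
    by (auto simp: two_chain_def)
  then have sub: "Field (P1 r) \<subseteq> {x, y}" by (auto simp: Field_def)
  obtain z where z: "z \<in> Field r" "\<rho> z = k" using rank_attained by blast
  then have "z \<noteq> s" using k_pos rank_bot[OF bot] by auto
  moreover have "{None, Some s, Some z} \<subseteq> {x, y}"
    using sub s_Field z by (auto simp: Field_P1)
  ultimately show False by auto
qed

section \<open>The local cd-index as a sum of chain weights\<close>

lemma chain_weight_SS:
  assumes "y \<in> Field r"
  shows "chain_weight Q (rk Q) (SS s) (SS y) = chain_weight r \<rho> s y"
proof -
  have "psi Q (rk Q) (SS s) (SS y) = psi r \<rho> s y"
  proof (rule psi_embedding[where f = SS and S = "Field r"])
    show "z \<in> SS ` Field r" if "(z, SS x) \<in> Q" for x z
      using that by (rule below_SS) (auto intro: FieldI1)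
  qed (use assms Q.ranked_poset_axioms s_le rk_SS s_Field in \<open>auto intro: FieldI2\<close>)
  then show ?thesis by (simp add: chain_weight_def)
qed

text \<open>The fresh maximum adjoined in \<open>boundary\<close> takes the place of the extra
  coatom, so the boundary is the lower interval of that coatom in \<open>Q\<close>, renamed by
  \<open>f\<close>.\<close>

lemma nc_subst_boundary:
  "nc_subst cd_to_ab (cd_index (boundary (P1 r))) = psi Q (rk Q) (SS s) None"
proof -
  define f :: "'a option option \<Rightarrow> 'a option option option"
    where "f y = (if y = None then None else Some y)" for y
  define h :: "'a option option option \<Rightarrow> 'a option option"
    where "h y = (case y of None \<Rightarrow> None | Some z \<Rightarrow> z)" for y
  have hf: "h (f y) = y" for y by (simp add: h_def f_def)
  have le: "(SS s, None) \<in> Q" using s_bd by (simp add: bd_iff)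
  let ?I = "interval Q (SS s) None" and ?\<rho> = "\<lambda>x. rk Q x - rk Q (SS s)"
  interpret I: graded_ranked_poset ?I ?\<rho> by (rule Q.graded_interval[OF le])
  have below: "\<exists>y. u = Some y" if "(u, None) \<in> Q" "u \<noteq> None" for u
    using that by (cases u) auto
  have Field_I: "Field ?I = {u. (u, None) \<in> Q}"
    using bot_Q by (auto simp: Q.Field_interval is_bot_def intro: FieldI1)
  let ?R = "Restr Q {y. (y, None) \<in> Q \<and> y \<noteq> None}"
  have Field_R: "Field ?R = {y. (y, None) \<in> Q \<and> y \<noteq> None}"
    using Q.le_refl by (auto simp: Field_def)
  have iff: "(u, v) \<in> ?I \<longleftrightarrow> (u, v) \<in> Q \<and> (v, None) \<in> Q" for u v
    using bot_Q by (auto simp: Q.interval_iff is_bot_def intro: FieldI1)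
  have eq: "boundary (P1 r) = map_prod f f ` ?I"
  proof (rule set_eqI, clarify)
    fix u v
    \<comment> \<open>The conditions \<open>f (h u) = u\<close> and \<open>f (h v) = v\<close>
      exclude \<open>Some None\<close>, which would be the copy of the coatom that \<open>f\<close>
      replaces by the fresh maximum.\<close>
    have "(u, v) \<in> map_prod f f ` ?I \<longleftrightarrow> f (h u) = u \<and> f (h v) = v \<and> (h u, h v) \<in> ?I"
    proof
      assume "(u, v) \<in> map_prod f f ` ?I"
      then show "f (h u) = u \<and> f (h v) = v \<and> (h u, h v) \<in> ?I" by (auto simp: hf)
    next
      assume "f (h u) = u \<and> f (h v) = v \<and> (h u, h v) \<in> ?I"
      then show "(u, v) \<in> map_prod f f ` ?I"
        using map_prod_imageI[of "h u" "h v" ?I f f] by simp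
    qed
    also have "\<dots> \<longleftrightarrow> (u, v) \<in> P1 ?R"
      using Q.le_trans[of "the u" "the v" None] Q.antisym[of None "the v"]
      by (cases u; cases v) (auto simp: f_def h_def iff Field_R simp del: not_None_eq)
    finally show "(u, v) \<in> boundary (P1 r) \<longleftrightarrow> (u, v) \<in> map_prod f f ` ?I"
      by (simp add: boundary_def semisuspension_eq Let_def)
  qed
  let ?B = "map_prod f f ` ?I"
  interpret B: graded_ranked_poset ?B "?\<rho> \<circ> h" by (rule I.graded_image) (rule hf)
  have B_iff: "(f x, f y) \<in> ?B \<longleftrightarrow> (x, y) \<in> ?I" for x y
  proof
    assume "(f x, f y) \<in> ?B"
    then obtain x' y' where *: "f x = f x'" "f y = f y'" "(x', y') \<in> ?I" by auto
    then have "x = x'" "y = y'" using hf by metis+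
    with * show "(x, y) \<in> ?I" by simp
  qed auto
  have Field_B: "Field ?B = f ` Field ?I"
    by (force simp: Field_def)
  have "ab_index ?B = psi ?B (?\<rho> \<circ> h) (f (SS s)) (f None)"
  proof (rule ab_index_eq_psi[OF B.graded_ranked_poset_axioms])
    show "is_bot ?B (f (SS s))" "is_top ?B (f None)"
      using Q.interval_bot_top[OF le] unfolding is_bot_def is_top_def Field_B by (auto simp: B_iff)
  qed (simp add: f_def)
  also have "\<dots> = psi ?I ?\<rho> (SS s) None"
  proof (rule I.psi_embedding[where S = "Field ?I"])
    show "z \<in> f ` Field ?I" if "(f (SS s), z) \<in> ?B" for z
      using FieldI2[OF that] by (simp only: Field_B)
    show "ranked_poset ?B (?\<rho> \<circ> h)" by (rule B.ranked_poset_axioms)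
  qed (use Q.interval_bot_top[OF le] B_iff hf in
      \<open>auto simp: is_bot_def is_top_def intro: FieldI2\<close>)
  also have "\<dots> = ab_index ?I"
    by (rule ab_index_eq_psi[OF I.graded_ranked_poset_axioms Q.interval_bot_top[OF le], symmetric]) simp
  also have "\<dots> = psi Q (rk Q) (SS s) None"
    by (rule Q.ab_index_interval[OF le]) simp
  finally have "ab_index ?B = psi Q (rk Q) (SS s) None" .
  moreover have "is_cd_poly (psi Q (rk Q) (SS s) None)"
    by (rule Q.is_cd_poly_psi[OF le]) simp
  ultimately show ?thesis
    using nc_subst_cd_index[of ?B] by (simp add: eq)
qed

lemma psi_Q_None:
  "psi Q (rk Q) (SS s) None = (\<Sum>y\<in>bd. chain_weight r \<rho> s y * (av - bv) ^ (k - 1 - \<rho> y))"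
proof -
  have le: "(SS s, None) \<in> Q" using s_bd by (simp add: bd_iff)
  have "{z. (SS s, z) \<in> Q \<and> (z, None) \<in> Q \<and> z \<noteq> None} = SS ` bd"
  proof (rule set_eqI)
    fix u
    show "u \<in> {z. (SS s, z) \<in> Q \<and> (z, None) \<in> Q \<and> z \<noteq> None} \<longleftrightarrow> u \<in> SS ` bd"
      using s_le bd_Field by (cases u; cases "the u") (auto simp: bd_iff)
  qed
  then have "psi Q (rk Q) (SS s) None =
      (\<Sum>z\<in>SS ` bd. chain_weight Q (rk Q) (SS s) z * (av - bv) ^ (rk Q None - rk Q z - 1))"
    using Q.psi_chain_weight[OF le] by simp
  also have "\<dots> = (\<Sum>y\<in>bd. chain_weight r \<rho> s y * (av - bv) ^ (k - 1 - \<rho> y))"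
    using bd_Field
    by (subst sum.reindex) (auto simp: inj_on_def chain_weight_SS rk_SS rk_None diff_right_commute intro!: sum.cong)
  finally show ?thesis .
qed

text \<open>The first term comes from the chains through the extra coatom; its rank is just below
  the top, so no \<open>e\<close> follows the \<open>b\<close>.\<close>

lemma psi_Q_top:
  "psi Q (rk Q) (SS s) (Some None) = psi Q (rk Q) (SS s) None * bv +
     (\<Sum>y\<in>Field r. chain_weight r \<rho> s y * (av - bv) ^ (k - \<rho> y))"
proof -
  have "{z. (SS s, z) \<in> Q \<and> (z, Some None) \<in> Q \<and> z \<noteq> Some None} = insert None (SS ` Field r)"
  proof (rule set_eqI)
    fix u
    show "u \<in> {z. (SS s, z) \<in> Q \<and> (z, Some None) \<in> Q \<and> z \<noteq> Some None} \<longleftrightarrow>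
        u \<in> insert None (SS ` Field r)"
      using s_le s_bd by (cases u; cases "the u") (auto simp: bd_iff)
  qed
  then have "psi Q (rk Q) (SS s) (Some None) =
      (\<Sum>z\<in>insert None (SS ` Field r). chain_weight Q (rk Q) (SS s) z * (av - bv) ^ (k + 1 - rk Q z - 1))"
    using Q.psi_chain_weight[of "SS s" "Some None"] s_Field by (simp add: rk_top)
  also have "\<dots> = chain_weight Q (rk Q) (SS s) None +
      (\<Sum>z\<in>SS ` Field r. chain_weight Q (rk Q) (SS s) z * (av - bv) ^ (k + 1 - rk Q z - 1))"
    using finite_Field by (subst sum.insert) (auto simp: rk_None)
  also have "(\<Sum>z\<in>SS ` Field r. chain_weight Q (rk Q) (SS s) z * (av - bv) ^ (k + 1 - rk Q z - 1)) =
      (\<Sum>y\<in>Field r. chain_weight r \<rho> s y * (av - bv) ^ (k - \<rho> y))"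
    by (subst sum.reindex) (auto simp: inj_on_def chain_weight_SS rk_SS intro!: sum.cong)
  finally show ?thesis by (simp add: chain_weight_def)
qed

text \<open>Subtracting the boundary index times \<open>a + b\<close> cancels the chains through the
  extra coatom and leaves the boundary index times \<open>- a\<close>. A boundary element, whose
  rank is below \<open>k\<close>, has a factor \<open>e\<close> to spare, and
  \<open>e - a = - b\<close>.\<close>

lemma nc_subst_local_cd_index:
  "nc_subst cd_to_ab (local_cd_index (P1 r)) =
     (\<Sum>y\<in>Field r - bd. chain_weight r \<rho> s y * (av - bv) ^ (k - \<rho> y)) -
     (\<Sum>y\<in>bd. chain_weight r \<rho> s y * (av - bv) ^ (k - 1 - \<rho> y) * bv)"
proof -
  let ?W = "chain_weight r \<rho> s" and ?b = "psi Q (rk Q) (SS s) None"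
  have "nc_subst cd_to_ab (cd_index Q) = psi Q (rk Q) (SS s) (Some None)"
    by (rule nc_subst_cd_index_eulerian[OF Q_eulerian bot_Q top]) simp
  then have "nc_subst cd_to_ab (local_cd_index (P1 r)) = psi Q (rk Q) (SS s) (Some None) - ?b * (av + bv)"
    by (simp add: local_cd_index_def not_two_chain semisuspension_eq nc_subst_diff nc_subst_mult
        nc_subst_boundary)
  also have "\<dots> = (\<Sum>y\<in>Field r. ?W y * (av - bv) ^ (k - \<rho> y)) - ?b * av"
    by (simp add: psi_Q_top distrib_left)
  also have "(\<Sum>y\<in>Field r. ?W y * (av - bv) ^ (k - \<rho> y)) =
      (\<Sum>y\<in>Field r - bd. ?W y * (av - bv) ^ (k - \<rho> y)) + (\<Sum>y\<in>bd. ?W y * (av - bv) ^ (k - \<rho> y))"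
    by (rule sum.subset_diff[OF bd_Field finite_Field])
  also have "(\<Sum>y\<in>bd. ?W y * (av - bv) ^ (k - \<rho> y)) =
      (\<Sum>y\<in>bd. ?W y * (av - bv) ^ (k - 1 - \<rho> y) * (av - bv))"
  proof (rule sum.cong[OF refl])
    fix y assume "y \<in> bd"
    then have "k - \<rho> y = Suc (k - 1 - \<rho> y)" using rank_bd[of y] by simp
    then show "?W y * (av - bv) ^ (k - \<rho> y) = ?W y * (av - bv) ^ (k - 1 - \<rho> y) * (av - bv)"
      by (simp only: power_Suc2 mult.assoc)
  qed
  finally show ?thesis
    by (simp add: psi_Q_None sum_distrib_right right_diff_distrib sum_subtractf)
qed

end

section \<open>Strong Eulerian subdivisions\<close>

lemma alternating_sum_interval:
  assumes "eulerian r" "(s, t) \<in> r"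
  shows "(\<Sum>z | (s, z) \<in> r \<and> (z, t) \<in> r. (- 1) ^ rk r z) = (if s = t then (- 1) ^ rk r t else 0 :: int)"
proof -
  interpret eulerian_ranked_poset r "rk r" by (rule eulerian_ranked[OF assms(1)])
  have "{z. (t, z) \<in> r \<and> (z, t) \<in> r} = {t}"
    using le_refl[OF assms(2)] antisym[of _ t] by auto
  then show ?thesis
    using alternating_sum[OF assms(2)] by simp
qed

locale subdivision =
  fixes P :: "'a rel" and Ph :: "'b rel" and \<phi> :: "'b \<Rightarrow> 'a"
  assumes eulerian_P: "eulerian P" and eulerian_Ph: "eulerian Ph"
    and subdivision: "strong_eulerian_subdivision Ph P \<phi>"
    and top_fibre: "\<And>x. x \<in> Field Ph \<Longrightarrow> \<phi> x = top_elem P \<Longrightarrow> x = top_elem Ph"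
begin

sublocale P: eulerian_ranked_poset P "rk P" by (rule eulerian_ranked[OF eulerian_P])
sublocale Ph: eulerian_ranked_poset Ph "rk Ph" by (rule eulerian_ranked[OF eulerian_Ph])
sublocale P: graded_ranked_poset P "rk P" by (rule eulerian_ranked[OF eulerian_P])
sublocale Ph: graded_ranked_poset Ph "rk Ph" by (rule eulerian_ranked[OF eulerian_Ph])

abbreviation tP :: 'a where "tP \<equiv> top_elem P"
abbreviation tPh :: 'b where "tPh \<equiv> top_elem Ph"

lemma mono: "(x, y) \<in> Ph \<Longrightarrow> (\<phi> x, \<phi> y) \<in> P"
  and image: "\<phi> ` Field Ph = Field P"
  and near_eulerian: "\<sigma> \<in> Field P \<Longrightarrow> near_eulerian (P1 (below_preimage Ph P \<phi> \<sigma>))"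
  and rank_below_preimage: "\<sigma> \<in> Field P \<Longrightarrow> poset_rank (below_preimage Ph P \<phi> \<sigma>) = rk P \<sigma>"
  using subdivision by (auto simp: strong_eulerian_subdivision_def)

lemma phi_Field: "x \<in> Field Ph \<Longrightarrow> \<phi> x \<in> Field P"
  using image by auto

lemma reflP: "\<sigma> \<in> Field P \<Longrightarrow> (\<sigma>, \<sigma>) \<in> P" and reflPh: "x \<in> Field Ph \<Longrightarrow> (x, x) \<in> Ph"
  using P.le_refl Ph.le_refl by (auto simp: Field_def)

lemma is_top_top_elem:
  assumes "Partial_order r" "\<exists>x. is_top r x"
  shows "is_top r (top_elem r)"
proof -
  obtain x where x: "is_top r x" using assms(2) by blast
  have "y = x" if "is_top r y" for y
    using that x assms(1) by (auto simp: is_top_def order_on_defs antisym_def)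
  with x show ?thesis unfolding top_elem_def by (rule theI)
qed

lemma tP: "is_top P tP" and tPh: "is_top Ph tPh"
  using eulerian_P eulerian_Ph is_top_top_elem P.partial_order Ph.partial_order
  by (auto simp: eulerian_def)

lemma tP_le: "\<sigma> \<in> Field P \<Longrightarrow> (\<sigma>, tP) \<in> P" and tP_Field: "tP \<in> Field P"
  and tPh_le: "x \<in> Field Ph \<Longrightarrow> (x, tPh) \<in> Ph" and tPh_Field: "tPh \<in> Field Ph"
  using tP tPh by (auto simp: is_top_def)

lemma phi_top_iff: "x \<in> Field Ph \<Longrightarrow> \<phi> x = tP \<longleftrightarrow> x = tPh"
proof
  obtain y where y: "y \<in> Field Ph" "\<phi> y = tP" using image tP_Field by force
  then have "\<phi> tPh = tP" using top_fibre by metis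
  then show "x = tPh \<Longrightarrow> \<phi> x = tP" by simp
qed (rule top_fibre)

definition bP :: 'a where "bP = (SOME x. is_bot P x)"
definition bPh :: 'b where "bPh = (SOME x. is_bot Ph x)"

lemma bP: "is_bot P bP" and bPh: "is_bot Ph bPh"
  using eulerian_P eulerian_Ph unfolding bP_def bPh_def by (auto simp: eulerian_def intro: someI_ex)

lemma bP_le: "\<sigma> \<in> Field P \<Longrightarrow> (bP, \<sigma>) \<in> P" and bP_Field: "bP \<in> Field P"
  and bPh_le: "x \<in> Field Ph \<Longrightarrow> (bPh, x) \<in> Ph" and bPh_Field: "bPh \<in> Field Ph"
  using bP bPh by (auto simp: is_bot_def)

lemma phi_bot: "\<phi> bPh = bP"
proof -
  obtain y where y: "y \<in> Field Ph" "\<phi> y = bP" using image bP_Field by force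
  then have "(\<phi> bPh, bP) \<in> P" using mono[OF bPh_le] by metis
  then show ?thesis using P.antisym bP_le phi_Field bPh_Field by blast
qed

section \<open>Preimages of lower intervals\<close>

abbreviation \<Gamma> :: "'a \<Rightarrow> 'b rel" where "\<Gamma> \<equiv> below_preimage Ph P \<phi>"

lemma \<Gamma>_graded: "graded_ranked_poset (\<Gamma> \<sigma>) (rk Ph)"
  unfolding below_preimage_def
  by (rule Ph.graded_down_set) (use mono P.le_trans in blast)

lemma \<Gamma>_iff: "(x, y) \<in> \<Gamma> \<sigma> \<longleftrightarrow> (x, y) \<in> Ph \<and> (\<phi> y, \<sigma>) \<in> P"
  unfolding below_preimage_def using mono[of x y] P.le_trans[of "\<phi> x" "\<phi> y" \<sigma>] by auto

lemma Field_\<Gamma>: "Field (\<Gamma> \<sigma>) = {x \<in> Field Ph. (\<phi> x, \<sigma>) \<in> P}"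
proof -
  have "x \<in> Field (\<Gamma> \<sigma>)" if "x \<in> Field Ph" "(\<phi> x, \<sigma>) \<in> P" for x
    using FieldI1[of x x "\<Gamma> \<sigma>"] that reflPh by (simp add: \<Gamma>_iff)
  moreover have "x \<in> Field Ph \<and> (\<phi> x, \<sigma>) \<in> P" if "x \<in> Field (\<Gamma> \<sigma>)" for x
    using that unfolding Field_def below_preimage_def by auto
  ultimately show ?thesis by blast
qed

lemma \<Gamma>_bot: "\<sigma> \<in> Field P \<Longrightarrow> is_bot (\<Gamma> \<sigma>) bPh"
  using bP_le bPh_le bPh_Field by (auto simp: is_bot_def Field_\<Gamma> \<Gamma>_iff phi_bot)

lemma finite_Field_\<Gamma>: "finite (Field (\<Gamma> \<sigma>))"
  by (rule finite_subset[OF _ Ph.finite_Field]) (auto simp: Field_\<Gamma>)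

lemma rank_\<Gamma>:
  assumes "\<sigma> \<in> Field P"
  shows "\<exists>y\<in>Field (\<Gamma> \<sigma>). rk Ph y = rk P \<sigma>" "\<And>y. y \<in> Field (\<Gamma> \<sigma>) \<Longrightarrow> rk Ph y \<le> rk P \<sigma>"
proof -
  interpret G: graded_ranked_poset "\<Gamma> \<sigma>" "rk Ph" by (rule \<Gamma>_graded)
  have Max: "Max (rk Ph ` Field (\<Gamma> \<sigma>)) = rk P \<sigma>"
    using rank_below_preimage[OF assms] G.poset_rank_eq_Max by simp
  have "Field (\<Gamma> \<sigma>) \<noteq> {}" using \<Gamma>_bot[OF assms] by (auto simp: is_bot_def)
  then show "\<exists>y\<in>Field (\<Gamma> \<sigma>). rk Ph y = rk P \<sigma>"
    using Max_in[of "rk Ph ` Field (\<Gamma> \<sigma>)"] finite_Field_\<Gamma> unfolding Max by auto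
  show "\<And>y. y \<in> Field (\<Gamma> \<sigma>) \<Longrightarrow> rk Ph y \<le> rk P \<sigma>"
    using Max_ge[of "rk Ph ` Field (\<Gamma> \<sigma>)"] finite_Field_\<Gamma> unfolding Max by auto
qed

lemma rank_phi: "y \<in> Field Ph \<Longrightarrow> rk Ph y \<le> rk P (\<phi> y)"
  using rank_\<Gamma>(2)[of "\<phi> y" y] phi_Field reflP by (simp add: Field_\<Gamma>)

lemma semisuspended_\<Gamma>:
  assumes "\<sigma> \<in> Field P" "is_semisuspension (P1 (\<Gamma> \<sigma>)) Q"
  shows "semisuspended (\<Gamma> \<sigma>) (rk Ph) bPh (rk P \<sigma>) Q"
proof -
  interpret G: graded_ranked_poset "\<Gamma> \<sigma>" "rk Ph" by (rule \<Gamma>_graded)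
  show ?thesis
    by unfold_locales (use \<Gamma>_bot rank_\<Gamma> assms in auto)
qed

text \<open>A two-chain leaves no room for an element of positive rank. At the minimum a
  semisuspension is impossible, since it would force positive rank by \<open>k_pos\<close>.\<close>

lemma two_chain_P1_\<Gamma>:
  assumes "\<sigma> \<in> Field P"
  shows "two_chain (P1 (\<Gamma> \<sigma>)) \<longleftrightarrow> \<sigma> = bP"
proof
  assume "two_chain (P1 (\<Gamma> \<sigma>))"
  then obtain x y where "P1 (\<Gamma> \<sigma>) = {(x, x), (x, y), (y, y)}"
    by (auto simp: two_chain_def)
  then have sub: "Field (P1 (\<Gamma> \<sigma>)) \<subseteq> {x, y}" by (auto simp: Field_def)
  obtain z where z: "z \<in> Field (\<Gamma> \<sigma>)" "rk Ph z = rk P \<sigma>" using rank_\<Gamma>[OF assms] by blast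
  have "{None, Some bPh, Some z} \<subseteq> {x, y}"
    using sub z(1) \<Gamma>_bot[OF assms] unfolding Field_P1 is_bot_def by blast
  then have "z = bPh" by auto
  then have "rk P \<sigma> = 0" using z(2) Ph.rank_bot[OF bPh] by simp
  then show "\<sigma> = bP" using P.rank_less[OF bP_le[OF assms]] by fastforce
next
  assume "\<sigma> = bP"
  show "two_chain (P1 (\<Gamma> \<sigma>))"
  proof (rule ccontr)
    assume "\<not> two_chain (P1 (\<Gamma> \<sigma>))"
    then obtain Q where "is_semisuspension (P1 (\<Gamma> \<sigma>)) Q"
      using near_eulerian[OF assms] by (auto simp: near_eulerian_def)
    then interpret semisuspended "\<Gamma> \<sigma>" "rk Ph" bPh "rk P \<sigma>" Q
      by (rule semisuspended_\<Gamma>[OF assms])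
    show False using k_pos P.rank_bot[OF bP] \<open>\<sigma> = bP\<close> by simp
  qed
qed

lemma \<Gamma>_bP: "Field (\<Gamma> bP) = {bPh}"
proof -
  have "x = bPh" if "x \<in> Field (\<Gamma> bP)" for x
  proof -
    have "rk Ph x = 0" using rank_\<Gamma>(2)[OF bP_Field that] P.rank_bot[OF bP] by simp
    then show ?thesis
      using Ph.rank_less[of bPh x] bPh_le that by (fastforce simp: Field_\<Gamma>)
  qed
  then show ?thesis using \<Gamma>_bot[OF bP_Field] by (auto simp: is_bot_def)
qed

text \<open>At the minimum there is no semisuspension, and the only element counts as interior.\<close>

definition bdry :: "'a \<Rightarrow> 'b set" where
  "bdry \<sigma> = (if \<sigma> = bP then {} else
     {y \<in> Field (\<Gamma> \<sigma>). (SS y, None) \<in> semisuspension (P1 (\<Gamma> \<sigma>))})"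

lemma bdry_cases:
  assumes "\<sigma> \<in> Field P"
  obtains "\<sigma> = bP" "bdry \<sigma> = {}"
  | "\<sigma> \<noteq> bP" "semisuspended (\<Gamma> \<sigma>) (rk Ph) bPh (rk P \<sigma>) (semisuspension (P1 (\<Gamma> \<sigma>)))"
    "bdry \<sigma> = semisuspended.bd (\<Gamma> \<sigma>) (semisuspension (P1 (\<Gamma> \<sigma>)))"
proof (cases "\<sigma> = bP")
  case True
  then show ?thesis using that by (simp add: bdry_def)
next
  case False
  then obtain Q where Q: "is_semisuspension (P1 (\<Gamma> \<sigma>)) Q"
    using near_eulerian[OF assms] two_chain_P1_\<Gamma>[OF assms] by (auto simp: near_eulerian_def)
  interpret semisuspended "\<Gamma> \<sigma>" "rk Ph" bPh "rk P \<sigma>" Q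
    by (rule semisuspended_\<Gamma>[OF assms Q])
  show ?thesis
    using that(2) False semisuspended_axioms by (simp add: semisuspension_eq bdry_def bd_def)
qed

lemma bdry_Field: "\<sigma> \<in> Field P \<Longrightarrow> bdry \<sigma> \<subseteq> Field (\<Gamma> \<sigma>)"
  by (auto simp: bdry_def)

lemma bdry_down:
  assumes "\<sigma> \<in> Field P" "y \<in> bdry \<sigma>" "(x, y) \<in> Ph"
  shows "x \<in> bdry \<sigma>"
  using assms(1)
proof (cases rule: bdry_cases)
  case 2
  interpret semisuspended "\<Gamma> \<sigma>" "rk Ph" bPh "rk P \<sigma>" "semisuspension (P1 (\<Gamma> \<sigma>))" by (rule 2)
  have "(x, y) \<in> \<Gamma> \<sigma>"
    using assms bdry_Field by (auto simp: \<Gamma>_iff Field_\<Gamma>)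
  then show ?thesis using bd_down[of y x] assms(2) by (simp add: 2)
qed (use assms in simp)

text \<open>The convention at the minimum fits the formula: the only element counts as interior and
  gives the sum 1.\<close>

lemma alternating_sum_\<Gamma>:
  assumes "\<sigma> \<in> Field P" "y \<in> Field Ph" "(\<phi> y, \<sigma>) \<in> P"
  shows "(\<Sum>z | (y, z) \<in> Ph \<and> (\<phi> z, \<sigma>) \<in> P. (- 1) ^ rk Ph z) =
    (if y \<in> bdry \<sigma> then 0 else (- 1) ^ rk P \<sigma> :: int)"
  using assms(1)
proof (cases rule: bdry_cases)
  case 1
  have "y = bPh" using assms \<Gamma>_bP 1 by (auto simp: Field_\<Gamma>)
  moreover have "{z. (bPh, z) \<in> Ph \<and> (\<phi> z, bP) \<in> P} = {bPh}"
    using \<Gamma>_bP reflPh[OF bPh_Field] unfolding Field_\<Gamma> by (auto intro: FieldI2)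
  ultimately show ?thesis using 1 Ph.rank_bot[OF bPh] P.rank_bot[OF bP] by simp
next
  case 2
  interpret semisuspended "\<Gamma> \<sigma>" "rk Ph" bPh "rk P \<sigma>" "semisuspension (P1 (\<Gamma> \<sigma>))" by (rule 2)
  have "y \<in> Field (\<Gamma> \<sigma>)" using assms by (simp add: Field_\<Gamma>)
  from alternating_sum_up[OF this] show ?thesis by (simp add: 2 \<Gamma>_iff)
qed

text \<open>A maximal element of a fibre is interior, as the alternating sum over the elements above it
  has a single term.\<close>

lemma maximal_in_fibre_interior:
  assumes "y \<in> Field Ph" and max: "\<And>z. (y, z) \<in> Ph \<Longrightarrow> \<phi> z = \<phi> y \<Longrightarrow> z = y"
  shows "y \<notin> bdry (\<phi> y)"
proof
  assume "y \<in> bdry (\<phi> y)"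
  have "z = y" if "(y, z) \<in> Ph" "(\<phi> z, \<phi> y) \<in> P" for z
    using max[OF that(1)] P.antisym[OF that(2) mono[OF that(1)]] by simp
  then have "{z. (y, z) \<in> Ph \<and> (\<phi> z, \<phi> y) \<in> P} = {y}"
    using reflPh[OF assms(1)] reflP[OF phi_Field[OF assms(1)]] by auto
  then show False
    using alternating_sum_\<Gamma>[OF phi_Field[OF assms(1)] assms(1) reflP[OF phi_Field[OF assms(1)]]]
      \<open>y \<in> bdry (\<phi> y)\<close> by simp
qed

text \<open>Sum the alternating sums over all \<open>\<sigma>\<close>. The contribution of each \<open>z\<close> is an alternating
  sum over the interval from \<open>\<phi> z\<close> to the top, so that only the top survives.\<close>

lemma interior_unique:
  assumes "y \<in> Field Ph"
  shows "card {\<sigma>. (\<phi> y, \<sigma>) \<in> P \<and> y \<notin> bdry \<sigma>} = 1"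
proof -
  let ?S = "{\<sigma>. (\<phi> y, \<sigma>) \<in> P}"
  have fin: "finite ?S" using P.finite_up[of "\<phi> y" "\<lambda>_. True"] by simp
  have "int (card {\<sigma>. (\<phi> y, \<sigma>) \<in> P \<and> y \<notin> bdry \<sigma>}) = (\<Sum>\<sigma> | (\<phi> y, \<sigma>) \<in> P \<and> y \<notin> bdry \<sigma>. 1)"
    by simp
  also have "\<dots> = (\<Sum>\<sigma>\<in>?S. if y \<in> bdry \<sigma> then 0 else 1)"
    by (rule sum.mono_neutral_cong_left) (use fin in auto)
  \<comment> \<open>Multiplying by \<open>(- 1) ^ rk P \<sigma>\<close> makes the alternating sum an
    indicator of being interior.\<close>
  also have "\<dots> = (\<Sum>\<sigma>\<in>?S. (- 1) ^ rk P \<sigma> * (\<Sum>z | z \<in> {z. (y, z) \<in> Ph} \<and> (\<phi> z, \<sigma>) \<in> P. (- 1) ^ rk Ph z))"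
  proof (rule sum.cong[OF refl])
    fix \<sigma> assume "\<sigma> \<in> ?S"
    then have "\<sigma> \<in> Field P" "(\<phi> y, \<sigma>) \<in> P" by (auto intro: FieldI2)
    from alternating_sum_\<Gamma>[OF this(1) assms this(2)]
    show "(if y \<in> bdry \<sigma> then 0 else 1) = (- 1) ^ rk P \<sigma> *
        (\<Sum>z | z \<in> {z. (y, z) \<in> Ph} \<and> (\<phi> z, \<sigma>) \<in> P. (- 1 :: int) ^ rk Ph z)"
      by simp
  qed
  also have "\<dots> = (\<Sum>\<sigma>\<in>?S. \<Sum>z | z \<in> {z. (y, z) \<in> Ph} \<and> (\<phi> z, \<sigma>) \<in> P. (- 1) ^ rk P \<sigma> * (- 1) ^ rk Ph z)"
    by (simp add: sum_distrib_left)
  also have "\<dots> = (\<Sum>z | (y, z) \<in> Ph. \<Sum>\<sigma> | \<sigma> \<in> ?S \<and> (\<phi> z, \<sigma>) \<in> P. (- 1) ^ rk P \<sigma> * (- 1) ^ rk Ph z)"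
    by (rule sum.swap_restrict) (use fin Ph.finite_up[of y "\<lambda>_. True"] in auto)
  \<comment> \<open>Here the condition on the top fibre enters: the inner sum is nonzero only for
    \<open>\<phi> z = tP\<close>, and \<open>phi_top_iff\<close> turns this into
    \<open>z = tPh\<close>.\<close>
  also have "\<dots> = (\<Sum>z | (y, z) \<in> Ph. if z = tPh then (- 1) ^ rk P tP * (- 1) ^ rk Ph tPh else 0)"
  proof (rule sum.cong[OF refl])
    fix z assume "z \<in> {z. (y, z) \<in> Ph}"
    then have z: "(\<phi> y, \<phi> z) \<in> P" "z \<in> Field Ph" using mono by (auto intro: FieldI2)
    have "{\<sigma>. \<sigma> \<in> ?S \<and> (\<phi> z, \<sigma>) \<in> P} = {\<sigma>. (\<phi> z, \<sigma>) \<in> P \<and> (\<sigma>, tP) \<in> P}"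
      using P.le_trans[OF z(1)] tP_le by (auto intro: FieldI2)
    then show "(\<Sum>\<sigma> | \<sigma> \<in> ?S \<and> (\<phi> z, \<sigma>) \<in> P. (- 1) ^ rk P \<sigma> * (- 1) ^ rk Ph z) =
        (if z = tPh then (- 1) ^ rk P tP * (- 1) ^ rk Ph tPh else (0 :: int))"
      using alternating_sum_interval[OF eulerian_P tP_le[OF phi_Field[OF z(2)]]] phi_top_iff[OF z(2)]
      by (simp flip: sum_distrib_right)
  qed
  also have "\<dots> = (- 1) ^ rk P tP * (- 1) ^ rk Ph tPh"
    using tPh_le[OF assms] Ph.finite_up[of y "\<lambda>_. True"] by simp
  finally have eq: "int (card {\<sigma>. (\<phi> y, \<sigma>) \<in> P \<and> y \<notin> bdry \<sigma>}) = (- 1) ^ rk P tP * (- 1) ^ rk Ph tPh" .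
  \<comment> \<open>A cardinality that equals a sign must be 1, so the sign need not be
    computed.\<close>
  have "\<bar>(- 1) ^ rk P tP * (- 1) ^ rk Ph tPh :: int\<bar> = 1"
    by (simp add: abs_mult power_abs)
  with eq show ?thesis by linarith
qed

text \<open>The case \<open>\<phi> y \<noteq> \<sigma>\<close> is inherited from a maximal element above \<open>y\<close> in its fibre, because
  boundaries are down-closed; uniqueness then leaves only \<open>\<sigma> = \<phi> y\<close>.\<close>

lemma bdry_iff:
  assumes "(\<phi> y, \<sigma>) \<in> P" "y \<in> Field Ph"
  shows "y \<in> bdry \<sigma> \<longleftrightarrow> \<phi> y \<noteq> \<sigma>"
proof -
  obtain z where z: "(y, z) \<in> Ph \<and> \<phi> z = \<phi> y"
    and z_max: "\<And>w. (y, w) \<in> Ph \<and> \<phi> w = \<phi> y \<Longrightarrow> rk Ph w \<le> rk Ph z"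
    using ex_max_rank[of "{z. (y, z) \<in> Ph \<and> \<phi> z = \<phi> y}" "rk Ph"] Ph.finite_up[of y]
      reflPh[OF assms(2)] by auto
  have zF: "z \<in> Field Ph" using z by (auto intro: FieldI2)
  have "z \<notin> bdry (\<phi> z)"
  proof (rule maximal_in_fibre_interior[OF zF])
    fix w assume w: "(z, w) \<in> Ph" "\<phi> w = \<phi> z"
    then have "(y, w) \<in> Ph" using z Ph.le_trans by blast
    then show "w = z" using z_max[of w] w z Ph.rank_less[OF w(1)] by fastforce
  qed
  then have z_in: "\<phi> y \<in> {\<sigma>. (\<phi> z, \<sigma>) \<in> P \<and> z \<notin> bdry \<sigma>}"
    using z reflP[OF phi_Field[OF zF]] by simp
  have y_bdry: "y \<in> bdry \<tau>" if "(\<phi> y, \<tau>) \<in> P" "\<phi> y \<noteq> \<tau>" for \<tau>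
  proof -
    obtain u where "{\<sigma>. (\<phi> z, \<sigma>) \<in> P \<and> z \<notin> bdry \<sigma>} = {u}"
      using interior_unique[OF zF] by (rule card_1_singletonE)
    moreover have "\<phi> y \<in> {\<sigma>. (\<phi> z, \<sigma>) \<in> P \<and> z \<notin> bdry \<sigma>}" by (rule z_in)
    moreover have "\<tau> \<in> {\<sigma>. (\<phi> z, \<sigma>) \<in> P \<and> z \<notin> bdry \<sigma>}" if "z \<notin> bdry \<tau>"
      using that \<open>(\<phi> y, \<tau>) \<in> P\<close> z by simp
    ultimately have "z \<in> bdry \<tau>" using \<open>\<phi> y \<noteq> \<tau>\<close> by (metis singletonD)
    then show ?thesis using bdry_down[of \<tau> z y] that(1) z by (auto intro: FieldI2)
  qed
  obtain u where u: "{\<sigma>. (\<phi> y, \<sigma>) \<in> P \<and> y \<notin> bdry \<sigma>} = {u}"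
    using interior_unique[OF assms(2)] by (rule card_1_singletonE)
  then have "u = \<phi> y" using y_bdry by auto
  with u have "y \<notin> bdry (\<phi> y)" by auto
  then show ?thesis using y_bdry assms(1) by auto
qed

section \<open>Chain weights and the summation over both posets\<close>

abbreviation W :: "'b \<Rightarrow> ab nc_poly" where "W \<equiv> chain_weight Ph (rk Ph) bPh"

lemma chain_weight_\<Gamma>:
  assumes "y \<in> Field (\<Gamma> \<sigma>)" "\<sigma> \<in> Field P"
  shows "chain_weight (\<Gamma> \<sigma>) (rk Ph) bPh y = W y"
proof -
  interpret G: graded_ranked_poset "\<Gamma> \<sigma>" "rk Ph" by (rule \<Gamma>_graded)
  have "psi Ph (rk Ph) (id bPh) (id y) = psi (\<Gamma> \<sigma>) (rk Ph) bPh y"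
  proof (rule G.psi_embedding[where S = "Field (\<Gamma> \<sigma>)"])
    show "z \<in> id ` Field (\<Gamma> \<sigma>)" if "x \<in> Field (\<Gamma> \<sigma>)" "(z, id x) \<in> Ph" for x z
      using FieldI1[of z x "\<Gamma> \<sigma>"] that by (simp add: \<Gamma>_iff Field_\<Gamma>)
  qed (use assms Ph.ranked_poset_axioms \<Gamma>_bot in \<open>auto simp: \<Gamma>_iff Field_\<Gamma> is_bot_def intro: FieldI1\<close>)
  then show ?thesis by (simp add: chain_weight_def)
qed

text \<open>By \<open>bdry_iff\<close> the interior is the fibre over \<open>\<sigma>\<close>, so
  the semisuspension disappears from the formula. At the minimum the sums reduce to 1, the value
  fixed by convention.\<close>

lemma local_cd_index_\<Gamma>:
  assumes "\<sigma> \<in> Field P"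
  shows "nc_subst cd_to_ab (local_cd_index (P1 (\<Gamma> \<sigma>))) =
    (\<Sum>y | y \<in> Field Ph \<and> \<phi> y = \<sigma>. W y * (av - bv) ^ (rk P \<sigma> - rk Ph y)) -
    (\<Sum>y | y \<in> Field Ph \<and> (\<phi> y, \<sigma>) \<in> P \<and> \<phi> y \<noteq> \<sigma>. W y * (av - bv) ^ (rk P \<sigma> - 1 - rk Ph y) * bv)"
  using assms
proof (cases rule: bdry_cases)
  case 1
  have F: "x = bPh" if "x \<in> Field Ph" "(\<phi> x, bP) \<in> P" for x
  proof -
    have "x \<in> Field (\<Gamma> bP)" using that by (simp add: Field_\<Gamma>)
    then show ?thesis using \<Gamma>_bP by simp
  qed
  have interior: "{y. y \<in> Field Ph \<and> \<phi> y = bP} = {bPh}"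
    using F reflP[OF bP_Field] by (auto simp: phi_bot bPh_Field)
  have boundary: "{y. y \<in> Field Ph \<and> (\<phi> y, bP) \<in> P \<and> \<phi> y \<noteq> bP} = {}"
    by (auto dest: F simp: phi_bot)
  have "local_cd_index (P1 (\<Gamma> bP)) = 1"
    using two_chain_P1_\<Gamma>[OF bP_Field] by (simp add: local_cd_index_def)
  then show ?thesis
    unfolding 1(1) interior boundary using P.rank_bot[OF bP] by (simp add: chain_weight_def)
next
  case 2
  interpret semisuspended "\<Gamma> \<sigma>" "rk Ph" bPh "rk P \<sigma>" "semisuspension (P1 (\<Gamma> \<sigma>))" by (rule 2)
  have bd: "bd = {y. y \<in> Field Ph \<and> (\<phi> y, \<sigma>) \<in> P \<and> \<phi> y \<noteq> \<sigma>}"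
    using bdry_iff[of _ \<sigma>] bdry_Field[OF assms] 2 by (auto simp: Field_\<Gamma>)
  moreover have "Field (\<Gamma> \<sigma>) - bd = {y. y \<in> Field Ph \<and> \<phi> y = \<sigma>}"
    unfolding bd using reflP[OF assms] by (auto simp: Field_\<Gamma>)
  ultimately show ?thesis
    using chain_weight_\<Gamma>[OF _ assms]
    unfolding nc_subst_local_cd_index by (simp add: Field_\<Gamma> reflP assms)
qed

lemma psi_P_left:
  assumes "(s, tP) \<in> P" "s \<noteq> tP"
  shows "psi P (rk P) s tP = (av - bv) ^ (rk P tP - rk P s - 1) +
    (\<Sum>\<sigma> | \<sigma> \<in> Field P - {tP} \<and> (s, \<sigma>) \<in> P \<and> s \<noteq> \<sigma>. (av - bv) ^ (rk P \<sigma> - 1 - rk P s) * bv * psi P (rk P) \<sigma> tP)"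
proof -
  have "open_interval P s tP = {\<sigma>. \<sigma> \<in> Field P - {tP} \<and> (s, \<sigma>) \<in> P \<and> s \<noteq> \<sigma>}"
    using tP_le by (auto simp: open_interval_def intro: FieldI2)
  then show ?thesis by (subst P.psi_left) (simp add: diff_right_commute)
qed

text \<open>Each \<open>y\<close> other than the top meets one fibre term, at
  \<open>\<phi> y\<close>, and boundary terms at all larger \<open>\<sigma>\<close>. These are the
  left recursion for \<open>psi P (rk P) (\<phi> y) tP\<close> with only its pure power of
  \<open>e\<close> left over.\<close>

lemma psi_decomposition:
  assumes "bPh \<noteq> tPh" "rk P tP = rk Ph tPh"
  shows "psi Ph (rk Ph) bPh tPh =
    (\<Sum>\<sigma>\<in>Field P - {tP}. nc_subst cd_to_ab (local_cd_index (P1 (\<Gamma> \<sigma>))) * psi P (rk P) \<sigma> tP)"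
proof -
  let ?e = "\<lambda>k. (av - bv) ^ k" and ?S = "Field P - {tP}" and ?Y = "Field Ph - {tPh}"
  let ?\<psi> = "\<lambda>\<sigma>. psi P (rk P) \<sigma> tP"
  have fin: "finite ?S" "finite ?Y" using P.finite_Field Ph.finite_Field by auto
  have Y: "\<phi> y \<in> ?S" if "y \<in> ?Y" for y
    using that phi_Field phi_top_iff by auto
  have interior: "{y. y \<in> Field Ph \<and> \<phi> y = \<sigma>} = {y. y \<in> ?Y \<and> \<phi> y = \<sigma>}" if "\<sigma> \<in> ?S" for \<sigma>
    using that phi_top_iff by auto
  have below: "{y. y \<in> Field Ph \<and> (\<phi> y, \<sigma>) \<in> P \<and> \<phi> y \<noteq> \<sigma>} = {y. y \<in> ?Y \<and> (\<phi> y, \<sigma>) \<in> P \<and> \<phi> y \<noteq> \<sigma>}"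
    if "\<sigma> \<in> ?S" for \<sigma>
    using that phi_top_iff[OF tPh_Field] P.antisym[of tP \<sigma>] tP_le by auto
  have "(\<Sum>\<sigma>\<in>?S. nc_subst cd_to_ab (local_cd_index (P1 (\<Gamma> \<sigma>))) * ?\<psi> \<sigma>) =
      (\<Sum>\<sigma>\<in>?S. \<Sum>y | y \<in> ?Y \<and> \<phi> y = \<sigma>. W y * ?e (rk P \<sigma> - rk Ph y) * ?\<psi> \<sigma>) -
      (\<Sum>\<sigma>\<in>?S. \<Sum>y | y \<in> ?Y \<and> (\<phi> y, \<sigma>) \<in> P \<and> \<phi> y \<noteq> \<sigma>. W y * ?e (rk P \<sigma> - 1 - rk Ph y) * bv * ?\<psi> \<sigma>)"
    unfolding sum_subtractf[symmetric]
  proof (rule sum.cong[OF refl])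
    fix \<sigma> assume \<sigma>: "\<sigma> \<in> ?S"
    then have "\<sigma> \<in> Field P" by simp
    from local_cd_index_\<Gamma>[OF this] show "nc_subst cd_to_ab (local_cd_index (P1 (\<Gamma> \<sigma>))) * ?\<psi> \<sigma> =
      (\<Sum>y | y \<in> ?Y \<and> \<phi> y = \<sigma>. W y * ?e (rk P \<sigma> - rk Ph y) * ?\<psi> \<sigma>) -
      (\<Sum>y | y \<in> ?Y \<and> (\<phi> y, \<sigma>) \<in> P \<and> \<phi> y \<noteq> \<sigma>. W y * ?e (rk P \<sigma> - 1 - rk Ph y) * bv * ?\<psi> \<sigma>)"
      unfolding interior[OF \<sigma>] below[OF \<sigma>] by (simp only: left_diff_distrib sum_distrib_right)
  qed
  also have "\<dots> = (\<Sum>y\<in>?Y. \<Sum>\<sigma> | \<sigma> \<in> ?S \<and> \<phi> y = \<sigma>. W y * ?e (rk P \<sigma> - rk Ph y) * ?\<psi> \<sigma>) -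
      (\<Sum>y\<in>?Y. \<Sum>\<sigma> | \<sigma> \<in> ?S \<and> (\<phi> y, \<sigma>) \<in> P \<and> \<phi> y \<noteq> \<sigma>. W y * ?e (rk P \<sigma> - 1 - rk Ph y) * bv * ?\<psi> \<sigma>)"
    by (intro arg_cong2[of _ _ _ _ "(-)"] sum.swap_restrict fin)
  also have "\<dots> = (\<Sum>y\<in>?Y. W y * ?e (rk Ph tPh - rk Ph y - 1))"
    unfolding sum_subtractf[symmetric]
  proof (rule sum.cong[OF refl])
    fix y assume y: "y \<in> ?Y"
    let ?s = "\<phi> y"
    have s: "(?s, tP) \<in> P" "?s \<noteq> tP" using Y[OF y] tP_le by auto
    have ry: "rk Ph y \<le> rk P ?s" using rank_phi y by simp
    have "{\<sigma>. \<sigma> \<in> ?S \<and> ?s = \<sigma>} = {?s}" using Y[OF y] by auto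
    then have single: "(\<Sum>\<sigma> | \<sigma> \<in> ?S \<and> ?s = \<sigma>. W y * ?e (rk P \<sigma> - rk Ph y) * ?\<psi> \<sigma>) =
        W y * ?e (rk P ?s - rk Ph y) * ?\<psi> ?s"
      by (simp only:) simp
    have "(\<Sum>\<sigma> | \<sigma> \<in> ?S \<and> (?s, \<sigma>) \<in> P \<and> ?s \<noteq> \<sigma>. W y * ?e (rk P \<sigma> - 1 - rk Ph y) * bv * ?\<psi> \<sigma>) =
        W y * ?e (rk P ?s - rk Ph y) *
        (\<Sum>\<sigma> | \<sigma> \<in> ?S \<and> (?s, \<sigma>) \<in> P \<and> ?s \<noteq> \<sigma>. ?e (rk P \<sigma> - 1 - rk P ?s) * bv * ?\<psi> \<sigma>)"
      unfolding sum_distrib_left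
    proof (rule sum.cong[OF refl])
      fix \<sigma> assume "\<sigma> \<in> {\<sigma>. \<sigma> \<in> ?S \<and> (?s, \<sigma>) \<in> P \<and> ?s \<noteq> \<sigma>}"
      then have "rk P ?s < rk P \<sigma>" using P.rank_less[of ?s \<sigma>] by auto
      \<comment> \<open>Since \<open>rk Ph y \<le> rk P ?s < rk P \<sigma>\<close>, no subtraction
        truncates, and a common power of \<open>e\<close> can be pulled out on the left.\<close>
      then have "rk P \<sigma> - 1 - rk Ph y = (rk P ?s - rk Ph y) + (rk P \<sigma> - 1 - rk P ?s)"
        using ry by simp
      then show "W y * ?e (rk P \<sigma> - 1 - rk Ph y) * bv * ?\<psi> \<sigma> =
          W y * ?e (rk P ?s - rk Ph y) * (?e (rk P \<sigma> - 1 - rk P ?s) * bv * ?\<psi> \<sigma>)"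
        by (simp only: power_add mult.assoc)
    qed
    \<comment> \<open>The equal ranks of the two tops convert the exponent from \<open>P\<close> to
      \<open>Ph\<close>.\<close>
    moreover have "?e (rk P ?s - rk Ph y) * ?e (rk P tP - rk P ?s - 1) = ?e (rk Ph tPh - rk Ph y - 1)"
      using ry P.rank_less[OF s] assms(2) by (simp flip: power_add)
    ultimately show "(\<Sum>\<sigma> | \<sigma> \<in> ?S \<and> ?s = \<sigma>. W y * ?e (rk P \<sigma> - rk Ph y) * ?\<psi> \<sigma>) -
        (\<Sum>\<sigma> | \<sigma> \<in> ?S \<and> (?s, \<sigma>) \<in> P \<and> ?s \<noteq> \<sigma>. W y * ?e (rk P \<sigma> - 1 - rk Ph y) * bv * ?\<psi> \<sigma>) =
        W y * ?e (rk Ph tPh - rk Ph y - 1)"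
      unfolding single psi_P_left[OF s] by (simp add: distrib_left mult.assoc)
  qed
  also have "\<dots> = psi Ph (rk Ph) bPh tPh"
  proof -
    have "?Y = {z. (bPh, z) \<in> Ph \<and> (z, tPh) \<in> Ph \<and> z \<noteq> tPh}"
      using bPh_le tPh_le by (auto intro: FieldI1)
    then show ?thesis
      using Ph.psi_chain_weight[OF bPh_le[OF tPh_Field] assms(1)] by simp
  qed
  finally show ?thesis by simp
qed

text \<open>The only interior element is \<open>tPh\<close>, whose weight is the index of
  \<open>Ph\<close> times \<open>b\<close>. The boundary consists of everything below
  \<open>tPh\<close> and contributes the same product.\<close>

lemma local_cd_index_top:
  assumes "bPh \<noteq> tPh" "rk P tP = rk Ph tPh"
  shows "local_cd_index (P1 (\<Gamma> tP)) = 0"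
proof -
  have 1: "{y. y \<in> Field Ph \<and> \<phi> y = tP} = {tPh}"
    using phi_top_iff tPh_Field by auto
  have 2: "{y. y \<in> Field Ph \<and> (\<phi> y, tP) \<in> P \<and> \<phi> y \<noteq> tP} = {z. (bPh, z) \<in> Ph \<and> (z, tPh) \<in> Ph \<and> z \<noteq> tPh}"
    using phi_top_iff bPh_le tPh_le by (auto intro: FieldI1 tP_le phi_Field)
  have "nc_subst cd_to_ab (local_cd_index (P1 (\<Gamma> tP))) = nc_subst cd_to_ab 0"
    unfolding local_cd_index_\<Gamma>[OF tP_Field] 1 2
    using Ph.psi_chain_weight[OF bPh_le[OF tPh_Field] assms(1)] assms
    by (simp add: chain_weight_def sum_distrib_right diff_right_commute)
  then show ?thesis by (rule injD[OF inj_nc_subst_cd])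
qed

lemma rank_top_eq: "rk P tP = poset_rank P" "rk Ph tPh = poset_rank Ph"
proof -
  show "rk P tP = poset_rank P"
    unfolding poset_rank_def using P.finite_Field P.rank_le tP_le tP_Field
    by (intro Max_eqI[symmetric]) auto
  show "rk Ph tPh = poset_rank Ph"
    unfolding poset_rank_def using Ph.finite_Field Ph.rank_le tPh_le tPh_Field
    by (intro Max_eqI[symmetric]) auto
qed

lemma rank_top: "rk P tP = rk Ph tPh"
  using subdivision by (simp add: rank_top_eq strong_eulerian_subdivision_def)

lemma singleton:
  assumes "bPh = tPh"
  shows "Ph = {(bPh, bPh)}" "P = {(bP, bP)}"
proof -
  have x: "x = bPh" if "x \<in> Field Ph" for x
    using Ph.antisym[of x bPh] bPh_le[OF that] tPh_le[OF that] assms by simp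
  then have "\<sigma> = bP" if "\<sigma> \<in> Field P" for \<sigma>
    using that image phi_bot by auto
  then show "P = {(bP, bP)}"
    using reflP[OF bP_Field] by (auto intro: FieldI1 FieldI2)
  show "Ph = {(bPh, bPh)}"
    using x reflPh[OF bPh_Field] by (auto intro: FieldI1 FieldI2)
qed

theorem cd_index_decomposition:
  "cd_index Ph = (\<Sum>\<sigma>\<in>Field P. local_cd_index (P1 (\<Gamma> \<sigma>)) * cd_index (interval P \<sigma> tP))"
proof (cases "bPh = tPh")
  case True
  have tP: "tP = bP" using tP_Field singleton(2)[OF True] by (auto simp: Field_def)
  have "local_cd_index (P1 (\<Gamma> bP)) = 1"
    using two_chain_P1_\<Gamma>[OF bP_Field] by (simp add: local_cd_index_def)
  moreover have "cd_index Ph = 1"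
    using cd_index_singleton singleton(1)[OF True] by metis
  moreover have "interval P bP bP = {(bP, bP)}" "Field P = {bP}"
    using singleton(2)[OF True] by (auto simp: interval_def Field_def)
  ultimately show ?thesis by (simp add: tP cd_index_singleton)
next
  case False
  let ?f = "\<lambda>\<sigma>. local_cd_index (P1 (\<Gamma> \<sigma>)) * cd_index (interval P \<sigma> tP)"
  have fin: "finite (Field P - {tP})" using P.finite_Field by simp
  have "nc_subst cd_to_ab (cd_index Ph) = psi Ph (rk Ph) bPh tPh"
    by (rule nc_subst_cd_index_eulerian[OF eulerian_Ph bPh tPh False])
  also have "\<dots> = (\<Sum>\<sigma>\<in>Field P - {tP}. nc_subst cd_to_ab (?f \<sigma>))"
    unfolding psi_decomposition[OF False rank_top]
    by (intro sum.cong refl)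
      (simp add: nc_subst_mult nc_subst_cd_index_interval[OF eulerian_P tP_le])
  also have "\<dots> = nc_subst cd_to_ab (\<Sum>\<sigma>\<in>Field P - {tP}. ?f \<sigma>)"
    by (rule nc_subst_sum[OF fin, symmetric])
  \<comment> \<open>The term at \<open>tP\<close> can be restored because its local cd-index is 0,
    whatever its second factor.\<close>
  also have "(\<Sum>\<sigma>\<in>Field P - {tP}. ?f \<sigma>) = (\<Sum>\<sigma>\<in>Field P. ?f \<sigma>)"
    using P.finite_Field tP_Field local_cd_index_top[OF False rank_top]
    by (subst (2) sum.remove[of _ tP]) auto
  finally show ?thesis by (rule injD[OF inj_nc_subst_cd])
qed

end

theorem theorem6p1:
  fixes P :: "'a rel" and Ph :: "'b rel" and \<phi> :: "'b \<Rightarrow> 'a" and n :: nat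
  assumes "eulerian P" and "poset_rank P = n"
    and "eulerian Ph" and "poset_rank Ph = n"
    and "strong_eulerian_subdivision Ph P \<phi>"
    and top_fibre: "\<And>x. x \<in> Field Ph \<Longrightarrow> \<phi> x = top_elem P \<Longrightarrow> x = top_elem Ph"
  shows "cd_index Ph =
    (\<Sum>\<sigma>\<in>Field P. local_cd_index (P1 (below_preimage Ph P \<phi> \<sigma>)) *
                   cd_index (interval P \<sigma> (top_elem P)))"
proof -
  interpret subdivision P Ph \<phi>
    using assms by unfold_locales
  show ?thesis by (rule cd_index_decomposition)
qed

end
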